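(* Let $K_1, K_2$ be compact (Hausdorff) spaces and let $G$ be a compact (Hausdorff topological) group such that both $K_1$ and $K_2$ admit continuous surjections onto $G$. Then the Banach space $\mathcal C(K_1\times K_2)$ contains a complemented subspace isometric to $\mathcal C(G)$.
   Context: For a compact space $K$, $\mathcal C(K)$ denotes the Banach space of continuous real-valued functions on $K$ with the supremum norm. *)

theory Defs
  imports "HOL-Analysis.Analysis" "HOL-Algebra.Group"
begin

definition compact_topological_group :: "('g, 'm) monoid_scheme \<Rightarrow> 'g topology \<Rightarrow> bool" where
  "compact_topological_group G T \<longleftrightarrow>
     group G \<and> topspace T = carrier G \<and> compact_space T \<and> Hausdorff_space T \<and>
     continuous_map (prod_topology T T) T (\<lambda>(x, y). x \<otimes>\<^bsub>G\<^esub> y) \<and>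
     continuous_map T T (\<lambda>x. inv\<^bsub>G\<^esub> x)"

text \<open>The space C(K) of continuous real functions on K, represented extensionally
  (functions vanish outside the topspace).\<close>
definition cfun :: "'a topology \<Rightarrow> ('a \<Rightarrow> real) set" where
  "cfun K = {f. continuous_map K euclideanreal f \<and> (\<forall>x. x \<notin> topspace K \<longrightarrow> f x = 0)}"

definition sup_norm :: "'a topology \<Rightarrow> ('a \<Rightarrow> real) \<Rightarrow> real" where
  "sup_norm K f = (SUP x\<in>topspace K. \<bar>f x\<bar>)"

definition linear_on :: "('a \<Rightarrow> real) set \<Rightarrow> (('a \<Rightarrow> real) \<Rightarrow> ('b \<Rightarrow> real)) \<Rightarrow> bool" where
  "linear_on S T \<longleftrightarrow>
     (\<forall>f\<in>S. \<forall>g\<in>S. T (\<lambda>x. f x + g x) = (\<lambda>y. T f y + T g y)) \<and>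
     (\<forall>c. \<forall>f\<in>S. T (\<lambda>x. c * f x) = (\<lambda>y. c * T f y))"

definition linear_subspace_of :: "('a \<Rightarrow> real) set \<Rightarrow> ('a \<Rightarrow> real) set \<Rightarrow> bool" where
  "linear_subspace_of Y S \<longleftrightarrow> Y \<subseteq> S \<and> (\<lambda>x. 0) \<in> Y \<and>
     (\<forall>f\<in>Y. \<forall>g\<in>Y. (\<lambda>x. f x + g x) \<in> Y) \<and> (\<forall>c. \<forall>f\<in>Y. (\<lambda>x. c * f x) \<in> Y)"

definition complemented_subspace :: "'a topology \<Rightarrow> ('a \<Rightarrow> real) set \<Rightarrow> bool" where
  "complemented_subspace K Y \<longleftrightarrow> linear_subspace_of Y (cfun K) \<and>
     (\<exists>P. P ` cfun K = Y \<and> linear_on (cfun K) P \<and>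
          (\<exists>C. \<forall>f\<in>cfun K. sup_norm K (P f) \<le> C * sup_norm K f) \<and>
          (\<forall>f\<in>cfun K. P (P f) = P f))"

definition isometric_to_cfun :: "'a topology \<Rightarrow> ('a \<Rightarrow> real) set \<Rightarrow> 'b topology \<Rightarrow> bool" where
  "isometric_to_cfun K Y L \<longleftrightarrow>
     (\<exists>T. bij_betw T (cfun L) Y \<and> linear_on (cfun L) T \<and>
          (\<forall>f\<in>cfun L. sup_norm K (T f) = sup_norm L f))"

end

theory Submission
  imports Defs
begin

text \<open>Let \<open>\<phi>\<close> and \<open>\<psi>\<close> be the two surjections. The map \<open>f \<mapsto> f (\<phi> x \<otimes> \<psi> y)\<close> embeds
  \<open>C(G)\<close> isometrically into \<open>C(K\<^sub>1 \<times> K\<^sub>2)\<close>, and we need a bounded left inverse. Lift the Haar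
  integral \<open>I\<close> to positive functionals \<open>\<nu>\<^sub>1, \<nu>\<^sub>2\<close> on \<open>C(K\<^sub>1), C(K\<^sub>2)\<close> by Hahn-Banach, and let \<open>q\<close> be the
  conditional expectation of \<open>F\<close> given \<open>\<phi> x \<otimes> \<psi> y\<close>, that is,
  \<open>I (q u) = \<nu>\<^sub>2\<^sub>,\<^sub>y \<nu>\<^sub>1\<^sub>,\<^sub>x (F x y * u (\<phi> x \<otimes> \<psi> y))\<close> for all \<open>u \<in> C(G)\<close>. The point is that \<open>q\<close> has
  a continuous version: for \<open>F = a \<otimes> b\<close> it is the convolution of two bounded densities on \<open>G\<close>,
  approximated uniformly by replacing the density of \<open>a\<close> with a continuous function close to it in
  \<open>L\<^sup>2\<close>; the general case follows since sums of such \<open>F\<close> are dense and \<open>\<parallel>q\<parallel> \<le> \<parallel>F\<parallel>\<close>.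
  Measures are avoided throughout: integrals are positive linear functionals, and the Haar integral
  of \<open>f\<close> is the constant that is uniformly approximated by averages of left translates of \<open>f\<close> and
  by averages of right translates (von Neumann).\<close>

subsection \<open>Continuous functions on products with a compact factor\<close>

text \<open>The obstacle is continuity. With a single surjection, the conditional expectation of
  \<open>a\<close> is only a bounded density, defined up to null sets, and it may have no continuous
  version: if \<open>K1\<close> is a circle with every point split in two, a clopen set can have the
  indicator of an arc as its density. The second factor and the group law serve to smooth this,
  since convolving two bounded densities produces a continuous function. The group law has a second
  role: \<open>\<phi> x \<otimes> \<psi> y\<close> is again Haar distributed, so conditioning on it
  fixes every function of it. Finally, conditional expectations are unique only modulo null sets.
  Faithfulness of the Haar integral makes the continuous version unique, so that choosing one is a
  linear operation, and turns an inequality between integrals into a pointwise bound.\<close>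

abbreviation cont :: "'a topology \<Rightarrow> ('a \<Rightarrow> real) \<Rightarrow> bool" where
  "cont K f \<equiv> continuous_map K euclideanreal f"

abbreviation cont2 :: "'a topology \<Rightarrow> 'b topology \<Rightarrow> ('a \<Rightarrow> 'b \<Rightarrow> real) \<Rightarrow> bool" where
  "cont2 X Y F \<equiv> cont (prod_topology X Y) (\<lambda>p. F (fst p) (snd p))"

lemma continuous_map_comp:
  "continuous_map Y Z g \<Longrightarrow> continuous_map X Y f \<Longrightarrow> continuous_map X Z (\<lambda>x. g (f x))"
  using continuous_map_compose[of X Y f Z g] by (simp add: o_def)

lemmas cont_intros = continuous_map_real_mult continuous_map_add continuous_map_diff
  continuous_map_real_abs continuous_map_real_max continuous_map_sum continuous_map_canonical_const

lemma cont2_comp: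
  assumes "cont2 X Y F" "continuous_map Z X f" "continuous_map Z Y g"
  shows "cont Z (\<lambda>z. F (f z) (g z))"
proof -
  have "continuous_map Z (prod_topology X Y) (\<lambda>z. (f z, g z))"
    using assms(2,3) by (simp add: continuous_map_paired)
  from continuous_map_comp[OF assms(1) this] show ?thesis by simp
qed

lemma cont2_section_left: "cont2 X Y F \<Longrightarrow> y \<in> topspace Y \<Longrightarrow> cont X (\<lambda>x. F x y)"
  by (rule cont2_comp[where f = "\<lambda>x. x"]) auto

lemma cont2_section_right: "cont2 X Y F \<Longrightarrow> x \<in> topspace X \<Longrightarrow> cont Y (\<lambda>y. F x y)"
  by (rule cont2_comp[where g = "\<lambda>x. x"]) auto

lemma cont2_left: "cont X f \<Longrightarrow> cont2 X Y (\<lambda>x y. f x)"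
  by (rule continuous_map_comp[of _ _ f]) (auto intro: continuous_map_fst)

lemma cont2_right: "cont Y f \<Longrightarrow> cont2 X Y (\<lambda>x y. f y)"
  by (rule continuous_map_comp[of _ _ f]) (auto intro: continuous_map_snd)

lemma cont2_swap:
  assumes "cont2 X Y F" shows "cont2 Y X (\<lambda>y x. F x y)"
  by (rule cont2_comp[OF assms]) (auto intro: continuous_map_fst continuous_map_snd)

lemma cont_bounded:
  assumes "compact_space K" "cont K f"
  obtains M where "0 \<le> M" "\<And>x. x \<in> topspace K \<Longrightarrow> \<bar>f x\<bar> \<le> M"
proof -
  have "compactin euclidean (f ` topspace K)"
    using assms image_compactin compact_space_def by blast
  then have "bounded (f ` topspace K)"
    by (simp add: compact_imp_bounded)
  then obtain M where "\<forall>y\<in>f ` topspace K. norm y \<le> M"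
    by (auto simp: bounded_iff)
  then show ?thesis
    by (intro that[of "max 0 M"]) (auto simp: le_max_iff_disj)
qed

text \<open>The open set where the difference is below \<open>e\<close> contains the slice
  \<open>topspace X \<times> {y0}\<close>, and the tube lemma thickens the slice uniformly.\<close>

lemma compact_uniform_nhd:
  assumes X: "compact_space X" and F: "cont2 X Y F" and y0: "y0 \<in> topspace Y" and e: "0 < e"
  obtains V where "openin Y V" "y0 \<in> V"
    "\<And>x y. x \<in> topspace X \<Longrightarrow> y \<in> V \<Longrightarrow> \<bar>F x y - F x y0\<bar> < e"
proof -
  let ?h = "\<lambda>p. \<bar>F (fst p) (snd p) - F (fst p) y0\<bar>"
  have "cont (prod_topology X Y) ?h"
    by (intro cont_intros F cont2_left cont2_section_left[OF F y0])
  then have op: "openin (prod_topology X Y) {p \<in> topspace (prod_topology X Y). ?h p \<in> {..<e}}"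
    by (rule openin_continuous_map_preimage) (simp add: open_openin[symmetric])
  have "topspace X \<times> {y0} \<subseteq> {p \<in> topspace (prod_topology X Y). ?h p \<in> {..<e}}"
    using y0 e by auto
  from tube_lemma_left[OF op X[unfolded compact_space_def] y0 this] obtain U V
    where UV: "topspace X \<subseteq> U" "openin Y V" "y0 \<in> V"
      "U \<times> V \<subseteq> {p \<in> topspace (prod_topology X Y). ?h p \<in> {..<e}}" by blast
  show ?thesis
  proof (rule that[OF UV(2,3)])
    fix x y assume "x \<in> topspace X" "y \<in> V"
    then have "(x, y) \<in> U \<times> V" using UV(1) by auto
    then have "(x, y) \<in> {p \<in> topspace (prod_topology X Y). ?h p \<in> {..<e}}" using UV(4) by blast
    then show "\<bar>F x y - F x y0\<bar> < e" by simp
  qed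
qed

text \<open>The sections of \<open>F\<close> at the points \<open>y\<close> form a compact, hence
  totally bounded, set for the supremum norm. The centres supply tensor approximations and, for
  \<open>f (x \<otimes> y)\<close>, nets of translates.\<close>

lemma compact_uniform_net:
  assumes X: "compact_space X" and Y: "compact_space Y" and F: "cont2 X Y F" and e: "0 < e"
  obtains Z where "finite Z" "Z \<subseteq> topspace Y"
    "\<And>y. y \<in> topspace Y \<Longrightarrow> \<exists>z\<in>Z. \<forall>x\<in>topspace X. \<bar>F x y - F x z\<bar> < e"
proof -
  have "\<forall>z\<in>topspace Y. \<exists>V. openin Y V \<and> z \<in> V \<and> (\<forall>x\<in>topspace X. \<forall>y\<in>V. \<bar>F x y - F x z\<bar> < e)"
  proof
    fix z assume "z \<in> topspace Y"
    from compact_uniform_nhd[OF X F this e] obtain V where "openin Y V" "z \<in> V"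
      "\<And>x y. x \<in> topspace X \<Longrightarrow> y \<in> V \<Longrightarrow> \<bar>F x y - F x z\<bar> < e" by blast
    then show "\<exists>V. openin Y V \<and> z \<in> V \<and> (\<forall>x\<in>topspace X. \<forall>y\<in>V. \<bar>F x y - F x z\<bar> < e)"
      by (intro exI[of _ V]) simp
  qed
  then obtain V where V: "\<And>z. z \<in> topspace Y \<Longrightarrow> openin Y (V z) \<and> z \<in> V z \<and>
      (\<forall>x\<in>topspace X. \<forall>y\<in>V z. \<bar>F x y - F x z\<bar> < e)" by metis
  obtain Z where "finite Z" "Z \<subseteq> topspace Y" "topspace Y \<subseteq> \<Union> (V ` Z)"
  proof -
    have "topspace Y \<subseteq> \<Union> (V ` topspace Y)" using V by auto
    moreover have "\<And>U. U \<in> V ` topspace Y \<Longrightarrow> openin Y U" using V by auto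
    ultimately obtain W where "finite W" "W \<subseteq> V ` topspace Y" "topspace Y \<subseteq> \<Union> W"
      using compactinD[OF Y[unfolded compact_space_def], of "V ` topspace Y"] by blast
    then show thesis using that by (metis finite_subset_image)
  qed
  moreover have "\<exists>z\<in>Z. \<forall>x\<in>topspace X. \<bar>F x y - F x z\<bar> < e" if "y \<in> topspace Y" for y
  proof -
    obtain z where "z \<in> Z" "y \<in> V z" using \<open>topspace Y \<subseteq> _\<close> \<open>y \<in> topspace Y\<close> by blast
    then show ?thesis using V[of z] \<open>Z \<subseteq> _\<close> by blast
  qed
  ultimately show ?thesis using that by blast
qed

text \<open>Sending \<open>y\<close> to its section of \<open>F\<close> is continuous into the
  supremum norm, so any functional that is 1-Lipschitz for that norm may follow it. Suprema and
  states are the two instances.\<close>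

lemma lipschitz_section_cont:
  assumes X: "compact_space X" and F: "cont2 X Y F"
    and lip: "\<And>f g c. cont X f \<Longrightarrow> cont X g \<Longrightarrow> (\<And>x. x \<in> topspace X \<Longrightarrow> \<bar>f x - g x\<bar> \<le> c) \<Longrightarrow>
      \<bar>\<Phi> f - \<Phi> g\<bar> \<le> c"
  shows "cont Y (\<lambda>y. \<Phi> (\<lambda>x. F x y))"
  unfolding Met_TC.continuous_map_to_metric[where 'a = real, simplified mtopology_is_euclidean]
proof (intro ballI allI impI)
  fix y0 and e :: real assume y0: "y0 \<in> topspace Y" and e: "0 < e"
  from compact_uniform_nhd[OF X F y0, of "e / 2"] e obtain V where
    V: "openin Y V" "y0 \<in> V" "\<And>x y. x \<in> topspace X \<Longrightarrow> y \<in> V \<Longrightarrow> \<bar>F x y - F x y0\<bar> < e / 2"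
    by auto
  have "\<Phi> (\<lambda>x. F x y) \<in> ball (\<Phi> (\<lambda>x. F x y0)) e" if "y \<in> V" for y
  proof -
    have "y \<in> topspace Y" using V(1) that openin_subset by blast
    then have "\<bar>\<Phi> (\<lambda>x. F x y) - \<Phi> (\<lambda>x. F x y0)\<bar> \<le> e / 2"
      using V(3) that y0 by (intro lip cont2_section_left[OF F]) (auto intro: less_imp_le)
    then show ?thesis using e by (auto simp: dist_real_def abs_minus_commute)
  qed
  then show "\<exists>U. openin Y U \<and> y0 \<in> U \<and> (\<forall>y\<in>U. \<Phi> (\<lambda>x. F x y) \<in> Met_TC.mball (\<Phi> (\<lambda>x. F x y0)) e)"
    using V by auto
qed

lemma lipschitz_sup:
  fixes f g :: "'a \<Rightarrow> real"
  assumes "compact_space X" "topspace X \<noteq> {}" "cont X f" "cont X g"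
    and "\<And>x. x \<in> topspace X \<Longrightarrow> \<bar>f x - g x\<bar> \<le> c"
  shows "\<bar>(SUP x\<in>topspace X. f x) - (SUP x\<in>topspace X. g x)\<bar> \<le> c"
proof -
  have bdd: "bdd_above (h ` topspace X)" if h: "cont X h" for h
  proof -
    obtain M where "\<And>x. x \<in> topspace X \<Longrightarrow> \<bar>h x\<bar> \<le> M" using cont_bounded[OF assms(1) h] by metis
    then show ?thesis by (intro bdd_aboveI[of _ M]) (auto simp: abs_le_iff)
  qed
  have *: "(SUP x\<in>topspace X. f' x) \<le> (SUP x\<in>topspace X. g' x) + c"
    if "cont X g'" "\<And>x. x \<in> topspace X \<Longrightarrow> \<bar>f' x - g' x\<bar> \<le> c" for f' g'
  proof (rule cSUP_least[OF assms(2)])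
    fix x assume x: "x \<in> topspace X"
    have "f' x \<le> g' x + c" using that(2)[OF x] by linarith
    also have "g' x \<le> (SUP x\<in>topspace X. g' x)" using bdd[OF that(1)] x by (rule cSUP_upper2) auto
    finally show "f' x \<le> (SUP x\<in>topspace X. g' x) + c" by simp
  qed
  have "\<bar>g x - f x\<bar> \<le> c" if "x \<in> topspace X" for x using assms(5)[OF that] by simp
  from *[OF assms(3) this] *[OF assms(4,5)] show ?thesis by (simp add: abs_le_iff)
qed

text \<open>The partition of unity is built from the tents \<open>max 0 (e - d y z)\<close> of the continuous
  pseudometric \<open>d y z = sup\<^sub>x \<bar>F x y - F x z\<bar>\<close>, so no separation axiom is needed.\<close>

lemma cont2_approx_tensor:
  assumes X: "compact_space X" and Y: "compact_space Y" and F: "cont2 X Y F" and e: "0 < e"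
  shows "\<exists>Z b. finite Z \<and> Z \<subseteq> topspace Y \<and> (\<forall>z\<in>Z. cont Y (b z)) \<and>
    (\<forall>x\<in>topspace X. \<forall>y\<in>topspace Y. \<bar>F x y - (\<Sum>z\<in>Z. F x z * b z y)\<bar> \<le> e)"
proof (cases "topspace X = {}")
  case True
  then show ?thesis by (intro exI[of _ "{}"]) auto
next
  case False
  \<comment> \<open>The net is finer (\<open>e / 2\<close>) than the tents below (\<open>e\<close>),
    so at every point some tent has height at least \<open>e / 2\<close> and the normalising sum
    cannot vanish.\<close>
  obtain Z where Z: "finite Z" "Z \<subseteq> topspace Y"
    "\<And>y. y \<in> topspace Y \<Longrightarrow> \<exists>z\<in>Z. \<forall>x\<in>topspace X. \<bar>F x y - F x z\<bar> < e / 2"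
    using compact_uniform_net[OF X Y F, of "e / 2"] e by auto
  define d where "d z y = (SUP x\<in>topspace X. \<bar>F x y - F x z\<bar>)" for z y
  have F2: "cont2 X Y (\<lambda>x y. \<bar>F x y - F x z\<bar>)" if "z \<in> Z" for z
    using that Z(2) by (intro cont_intros F cont2_left cont2_section_left[OF F]) auto
  have dc: "cont Y (d z)" if "z \<in> Z" for z
    unfolding d_def
    by (rule lipschitz_section_cont[OF X F2[OF that], of "\<lambda>f. SUP x\<in>topspace X. f x"])
      (rule lipschitz_sup[OF X False])
  have dge: "\<bar>F x y - F x z\<bar> \<le> d z y" if z: "z \<in> Z" and x: "x \<in> topspace X" and y: "y \<in> topspace Y" for x y z
  proof -
    obtain M where "\<And>x. x \<in> topspace X \<Longrightarrow> \<bar>\<bar>F x y - F x z\<bar>\<bar> \<le> M"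
      using cont_bounded[OF X cont2_section_left[OF F2[OF z] y]] by metis
    then have "bdd_above ((\<lambda>x. \<bar>F x y - F x z\<bar>) ` topspace X)"
      by (intro bdd_aboveI[of _ M]) auto
    then show ?thesis unfolding d_def by (rule cSUP_upper2[OF _ x]) auto
  qed
  define t where "t z y = max 0 (e - d z y)" for z y
  define S where "S y = (\<Sum>z\<in>Z. t z y)" for y
  have tc: "cont Y (t z)" if "z \<in> Z" for z
    unfolding t_def by (intro cont_intros dc that)
  have t0: "0 \<le> t z y" for z y by (simp add: t_def)
  have S0: "0 < S y" if y: "y \<in> topspace Y" for y
  proof -
    obtain z where z: "z \<in> Z" "\<forall>x\<in>topspace X. \<bar>F x y - F x z\<bar> < e / 2" using Z(3)[OF y] by auto
    have "d z y \<le> e / 2" unfolding d_def by (rule cSUP_least[OF False]) (use z in \<open>auto intro: less_imp_le\<close>)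
    then have "0 < t z y" using e by (simp add: t_def)
    then show ?thesis unfolding S_def by (rule sum_pos2[OF Z(1) z(1) _ t0])
  qed
  define b where "b z y = t z y / S y" for z y
  have bc: "cont Y (b z)" if "z \<in> Z" for z
    unfolding b_def
  proof (rule continuous_map_real_divide[OF tc[OF that]])
    show "cont Y S" unfolding S_def by (intro cont_intros tc Z(1))
    show "S y \<noteq> 0" if "y \<in> topspace Y" for y using S0[OF that] by simp
  qed
  have "\<bar>F x y - (\<Sum>z\<in>Z. F x z * b z y)\<bar> \<le> e" if x: "x \<in> topspace X" and y: "y \<in> topspace Y" for x y
  proof -
    have "(\<Sum>z\<in>Z. b z y) = 1"
      using S0[OF y] unfolding b_def by (simp add: S_def flip: sum_divide_distrib)
    then have "F x y - (\<Sum>z\<in>Z. F x z * b z y) = (\<Sum>z\<in>Z. F x y * b z y) - (\<Sum>z\<in>Z. F x z * b z y)"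
      by (simp add: flip: sum_distrib_left)
    also have "\<dots> = (\<Sum>z\<in>Z. (F x y - F x z) * b z y)" by (simp add: sum_subtractf left_diff_distrib)
    finally have "\<bar>F x y - (\<Sum>z\<in>Z. F x z * b z y)\<bar> \<le> (\<Sum>z\<in>Z. \<bar>F x y - F x z\<bar> * b z y)"
      using sum_abs[of "\<lambda>z. (F x y - F x z) * b z y" Z] t0 S0[OF y] by (simp add: abs_mult b_def)
    also have "\<dots> \<le> (\<Sum>z\<in>Z. e * b z y)"
    proof (rule sum_mono)
      fix z assume z: "z \<in> Z"
      show "\<bar>F x y - F x z\<bar> * b z y \<le> e * b z y"
      proof (cases "d z y \<le> e")
        case True
        then show ?thesis using dge[OF z x y] t0[of z y] S0[OF y]
          by (intro mult_right_mono) (auto simp: b_def)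
      next
        case False
        then have "b z y = 0" by (simp add: b_def t_def)
        then show ?thesis by simp
      qed
    qed
    also have "\<dots> = e" using \<open>(\<Sum>z\<in>Z. b z y) = 1\<close> by (simp flip: sum_distrib_left)
    finally show ?thesis .
  qed
  then show ?thesis by (intro exI[of _ Z] exI[of _ b] conjI ballI Z bc)
qed

text \<open>The rate survives the limit: for fixed \<open>n\<close>, letting \<open>m\<close> tend
  to infinity in the Cauchy bound leaves \<open>c / real (Suc n)\<close>. Later error estimates rely
  on this explicit form.\<close>

lemma cont_uniform_Cauchy_limit:
  assumes "\<And>n. cont K (q n)"
    and "\<And>m n x. x \<in> topspace K \<Longrightarrow> \<bar>q m x - q n x\<bar> \<le> c * (1 / real (Suc m) + 1 / real (Suc n))"
  obtains g where "cont K g" "\<And>n x. x \<in> topspace K \<Longrightarrow> \<bar>q n x - g x\<bar> \<le> c / real (Suc n)"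
proof -
  have lim0: "(\<lambda>m. c * (1 / real (Suc m) + a)) \<longlonglongrightarrow> c * (0 + a)" for a
    by (intro tendsto_intros LIMSEQ_Suc[OF lim_1_over_n])
  have cau: "\<exists>N. \<forall>m n x. N \<le> m \<longrightarrow> N \<le> n \<longrightarrow> x \<in> topspace K \<longrightarrow> dist (q m x) (q n x) < e" if e: "0 < e" for e
  proof -
    have "(\<lambda>m. 1 / real (Suc m)) \<longlonglongrightarrow> 0" by (intro LIMSEQ_Suc[OF lim_1_over_n])
    \<comment> \<open>The summand 1 keeps the denominator positive whatever \<open>c\<close> is and
      makes the final factor \<open>2 * \<bar>c\<bar> / (2 * \<bar>c\<bar> + 1)\<close> strictly
      smaller than 1.\<close>
    then have "\<forall>\<^sub>F m in sequentially. 1 / real (Suc m) < e / (2 * \<bar>c\<bar> + 1)"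
      using e by (intro order_tendstoD(2)) auto
    then obtain N where N: "\<And>m. N \<le> m \<Longrightarrow> 1 / real (Suc m) < e / (2 * \<bar>c\<bar> + 1)"
      by (auto simp: eventually_sequentially)
    show ?thesis
    proof (intro exI allI impI)
      fix m n x assume "N \<le> m" "N \<le> n" "x \<in> topspace K"
      let ?r = "e / (2 * \<bar>c\<bar> + 1)"
      have "\<bar>q m x - q n x\<bar> \<le> c * (1 / real (Suc m) + 1 / real (Suc n))" using assms(2) \<open>x \<in> _\<close> .
      also have "\<dots> \<le> \<bar>c\<bar> * (1 / real (Suc m) + 1 / real (Suc n))" by (intro mult_right_mono) auto
      also have "\<dots> \<le> \<bar>c\<bar> * (?r + ?r)"
        using N[OF \<open>N \<le> m\<close>] N[OF \<open>N \<le> n\<close>] by (intro mult_left_mono) auto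
      also have "\<dots> = (2 * \<bar>c\<bar>) / (2 * \<bar>c\<bar> + 1) * e" by simp
      also have "\<dots> < 1 * e" by (intro mult_strict_right_mono e) (simp add: divide_less_eq)
      also have "\<dots> = e" by simp
      finally show "dist (q m x) (q n x) < e" by (simp add: dist_real_def)
    qed
  qed
  have "\<exists>g. cont K g \<and> (\<forall>e>0. \<forall>\<^sub>F n in sequentially. \<forall>x\<in>topspace K. dist (q n x) (g x) < e)"
  proof (rule Met_TC.continuous_map_uniformly_Cauchy_limit[where X = K and f = q, unfolded mtopology_is_euclidean], goal_cases)
    case 1
    show ?case by (simp add: complete_UNIV)
  next
    case 2
    show ?case by (simp add: assms(1))
  next
    case (3 e)
    then show ?case by (rule cau)
  next
    case (4 g)
    then show ?case by blast
  qed
  then obtain g where g: "cont K g"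
    "\<And>e. 0 < e \<Longrightarrow> \<forall>\<^sub>F n in sequentially. \<forall>x\<in>topspace K. dist (q n x) (g x) < e"
    by blast
  have "\<bar>q n x - g x\<bar> \<le> c / real (Suc n)" if x: "x \<in> topspace K" for n x
  proof -
    have "(\<lambda>m. q m x) \<longlonglongrightarrow> g x"
      by (intro tendstoI eventually_mono[OF g(2)]) (use x in auto)
    then have "(\<lambda>m. \<bar>q m x - q n x\<bar>) \<longlonglongrightarrow> \<bar>g x - q n x\<bar>" by (intro tendsto_intros)
    then have "\<bar>g x - q n x\<bar> \<le> c * (0 + 1 / real (Suc n))"
      by (rule LIMSEQ_le[OF _ lim0]) (intro exI allI impI assms(2)[OF x])
    then show ?thesis by (simp add: abs_minus_commute)
  qed
  with g(1) show ?thesis using that by blast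
qed

subsection \<open>Positive normalised functionals\<close>

text \<open>A state is a total function on \<open>'a \<Rightarrow> real\<close>, unconstrained on discontinuous functions. Positivity
  is only tested on \<open>topspace K\<close>, so values outside the space are irrelevant (\<open>state_cong\<close>).\<close>

definition state :: "'a topology \<Rightarrow> (('a \<Rightarrow> real) \<Rightarrow> real) \<Rightarrow> bool" where
  "state K \<nu> \<longleftrightarrow>
     (\<forall>f g. cont K f \<longrightarrow> cont K g \<longrightarrow> \<nu> (\<lambda>x. f x + g x) = \<nu> f + \<nu> g) \<and>
     (\<forall>c f. cont K f \<longrightarrow> \<nu> (\<lambda>x. c * f x) = c * \<nu> f) \<and>
     (\<forall>f. cont K f \<longrightarrow> (\<forall>x\<in>topspace K. 0 \<le> f x) \<longrightarrow> 0 \<le> \<nu> f) \<and>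
     \<nu> (\<lambda>x. 1) = 1"

lemma state_add: "state K \<nu> \<Longrightarrow> cont K f \<Longrightarrow> cont K g \<Longrightarrow> \<nu> (\<lambda>x. f x + g x) = \<nu> f + \<nu> g"
  by (simp add: state_def)

lemma state_cmult: "state K \<nu> \<Longrightarrow> cont K f \<Longrightarrow> \<nu> (\<lambda>x. c * f x) = c * \<nu> f"
  by (simp add: state_def)

lemma state_nonneg:
  "state K \<nu> \<Longrightarrow> cont K f \<Longrightarrow> (\<And>x. x \<in> topspace K \<Longrightarrow> 0 \<le> f x) \<Longrightarrow> 0 \<le> \<nu> f"
  by (simp add: state_def)

lemma state_const: "state K \<nu> \<Longrightarrow> \<nu> (\<lambda>x. c) = c"
  using state_cmult[of K \<nu> "\<lambda>x. 1" c] by (simp add: state_def)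

lemma state_multc: "state K \<nu> \<Longrightarrow> cont K f \<Longrightarrow> \<nu> (\<lambda>x. f x * c) = \<nu> f * c"
  using state_cmult[of K \<nu> f c] by (simp add: mult.commute)

lemma state_diff:
  assumes "state K \<nu>" "cont K f" "cont K g"
  shows "\<nu> (\<lambda>x. f x - g x) = \<nu> f - \<nu> g"
proof -
  have "\<nu> (\<lambda>x. f x + (-1) * g x) = \<nu> f + \<nu> (\<lambda>x. (-1) * g x)"
    by (intro state_add[OF assms(1)] cont_intros assms)
  then show ?thesis using state_cmult[OF assms(1,3), of "-1"] by simp
qed

lemma state_mono:
  assumes "state K \<nu>" "cont K f" "cont K g" "\<And>x. x \<in> topspace K \<Longrightarrow> f x \<le> g x"
  shows "\<nu> f \<le> \<nu> g"
  using state_nonneg[OF assms(1), of "\<lambda>x. g x - f x"] state_diff[OF assms(1,3,2)] assms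
  by (simp add: continuous_map_diff)

text \<open>Group identities hold only on the carrier, so terms under a state may be exchanged only
  there; monotonicity in both directions justifies it.\<close>

lemma state_cong:
  assumes "state K \<nu>" "cont K f" "\<And>x. x \<in> topspace K \<Longrightarrow> f x = g x"
  shows "\<nu> f = \<nu> g"
proof -
  have "cont K g" using continuous_map_eq[OF assms(2,3)] .
  then show ?thesis
    using state_mono[OF assms(1,2)] state_mono[OF assms(1) _ assms(2)] assms(3)
    by (intro antisym) auto
qed

lemma state_le_const:
  assumes "state K \<nu>" "cont K f" "\<And>x. x \<in> topspace K \<Longrightarrow> f x \<le> c"
  shows "\<nu> f \<le> c"
  using state_mono[OF assms(1,2), of "\<lambda>x. c"] assms(3) by (simp add: state_const[OF assms(1)])

lemma state_ge_const:
  assumes "state K \<nu>" "cont K f" "\<And>x. x \<in> topspace K \<Longrightarrow> c \<le> f x"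
  shows "c \<le> \<nu> f"
  using state_mono[OF assms(1) _ assms(2), of "\<lambda>x. c"] assms(3) by (simp add: state_const[OF assms(1)])

lemma state_bound:
  assumes "state K \<nu>" "cont K f" "\<And>x. x \<in> topspace K \<Longrightarrow> \<bar>f x\<bar> \<le> c"
  shows "\<bar>\<nu> f\<bar> \<le> c"
proof -
  have "\<nu> f \<le> c" by (rule state_le_const[OF assms(1,2)]) (use assms(3) in fastforce)
  moreover have "- c \<le> \<nu> f" by (rule state_ge_const[OF assms(1,2)]) (use assms(3) in fastforce)
  ultimately show ?thesis by linarith
qed

lemma state_lipschitz:
  assumes "state K \<nu>" "cont K f" "cont K g" "\<And>x. x \<in> topspace K \<Longrightarrow> \<bar>f x - g x\<bar> \<le> c"
  shows "\<bar>\<nu> f - \<nu> g\<bar> \<le> c"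
  using state_bound[OF assms(1) continuous_map_diff[OF assms(2,3)] assms(4)]
  by (simp add: state_diff[OF assms(1-3)])

lemma state_abs_le:
  assumes "state K \<nu>" "cont K f" "cont K g" "\<And>x. x \<in> topspace K \<Longrightarrow> \<bar>f x\<bar> \<le> g x"
  shows "\<bar>\<nu> f\<bar> \<le> \<nu> g"
proof -
  have "\<nu> f \<le> \<nu> g" by (rule state_mono[OF assms(1-3)]) (use assms(4) in fastforce)
  moreover have "\<nu> (\<lambda>x. (-1) * f x) \<le> \<nu> g"
  proof (rule state_mono[OF assms(1) _ assms(3)])
    show "cont K (\<lambda>x. (-1) * f x)" by (intro cont_intros assms(2))
    show "(-1) * f x \<le> g x" if "x \<in> topspace K" for x using assms(4)[OF that] by linarith
  qed
  ultimately show ?thesis unfolding state_cmult[OF assms(1,2)] by linarith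
qed

lemma state_sum:
  assumes "state K \<nu>" "finite I" "\<And>i. i \<in> I \<Longrightarrow> cont K (f i)"
  shows "\<nu> (\<lambda>x. \<Sum>i\<in>I. f i x) = (\<Sum>i\<in>I. \<nu> (f i))"
  using assms(2,3)
proof (induction I rule: finite_induct)
  case empty
  then show ?case using state_const[OF assms(1)] by simp
next
  case (insert i I)
  have "\<nu> (\<lambda>x. f i x + (\<Sum>i\<in>I. f i x)) = \<nu> (f i) + \<nu> (\<lambda>x. \<Sum>i\<in>I. f i x)"
    by (rule state_add[OF assms(1)]) (use insert in \<open>auto intro: continuous_map_sum\<close>)
  then show ?case using insert by simp
qed

lemma cont_state_section:
  assumes "compact_space X" "state X \<nu>" "cont2 X Y F"
  shows "cont Y (\<lambda>y. \<nu> (\<lambda>x. F x y))"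
  using assms(1,3) by (rule lipschitz_section_cont) (rule state_lipschitz[OF assms(2)])

text \<open>On a finite sum of products both iterated values are the same sum of products of values.
  Such sums are uniformly dense, and both sides change by at most \<open>e\<close> under a uniform
  change of size \<open>e\<close>.\<close>

lemma state_Fubini:
  assumes X: "compact_space X" and Y: "compact_space Y" and m: "state X \<mu>" and n: "state Y \<nu>"
    and F: "cont2 X Y F"
  shows "\<mu> (\<lambda>x. \<nu> (\<lambda>y. F x y)) = \<nu> (\<lambda>y. \<mu> (\<lambda>x. F x y))"
proof -
  have *: "\<bar>\<mu> (\<lambda>x. \<nu> (\<lambda>y. F x y)) - \<nu> (\<lambda>y. \<mu> (\<lambda>x. F x y))\<bar> \<le> 2 * e" if e: "0 < e" for e
  proof -
    obtain Z b where Z: "finite Z" "Z \<subseteq> topspace Y" and b: "\<And>z. z \<in> Z \<Longrightarrow> cont Y (b z)"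
      and approx: "\<And>x y. x \<in> topspace X \<Longrightarrow> y \<in> topspace Y \<Longrightarrow> \<bar>F x y - (\<Sum>z\<in>Z. F x z * b z y)\<bar> \<le> e"
      using cont2_approx_tensor[OF X Y F e] by blast
    define H where "H x y = (\<Sum>z\<in>Z. F x z * b z y)" for x y
    have Fz: "cont X (\<lambda>x. F x z)" if "z \<in> Z" for z
      using cont2_section_left[OF F] Z(2) that by blast
    have H: "cont2 X Y H"
      unfolding H_def by (intro cont_intros Z(1) cont2_left Fz cont2_right b)
    have nH: "\<nu> (\<lambda>y. H x y) = (\<Sum>z\<in>Z. F x z * \<nu> (b z))" for x
      unfolding H_def using b
      by (subst state_sum[OF n Z(1)]) (auto intro!: cont_intros sum.cong state_cmult[OF n])
    have mH: "\<mu> (\<lambda>x. H x y) = (\<Sum>z\<in>Z. \<mu> (\<lambda>x. F x z) * b z y)" for y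
      unfolding H_def using Fz
      by (subst state_sum[OF m Z(1)]) (auto intro!: cont_intros sum.cong state_multc[OF m])
    have "\<mu> (\<lambda>x. \<nu> (\<lambda>y. H x y)) = (\<Sum>z\<in>Z. \<mu> (\<lambda>x. F x z) * \<nu> (b z))"
      unfolding nH using Fz
      by (subst state_sum[OF m Z(1)]) (auto intro!: cont_intros sum.cong state_multc[OF m])
    moreover have "\<nu> (\<lambda>y. \<mu> (\<lambda>x. H x y)) = (\<Sum>z\<in>Z. \<mu> (\<lambda>x. F x z) * \<nu> (b z))"
      unfolding mH using b
      by (subst state_sum[OF n Z(1)]) (auto intro!: cont_intros sum.cong state_cmult[OF n])
    moreover have "\<bar>\<mu> (\<lambda>x. \<nu> (\<lambda>y. F x y)) - \<mu> (\<lambda>x. \<nu> (\<lambda>y. H x y))\<bar> \<le> e"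
      using cont_state_section[OF Y n cont2_swap[OF F]] cont_state_section[OF Y n cont2_swap[OF H]]
      by (rule state_lipschitz[OF m], intro state_lipschitz[OF n] cont2_section_right[OF F] cont2_section_right[OF H])
        (auto simp: H_def approx)
    moreover have "\<bar>\<nu> (\<lambda>y. \<mu> (\<lambda>x. F x y)) - \<nu> (\<lambda>y. \<mu> (\<lambda>x. H x y))\<bar> \<le> e"
      using cont_state_section[OF X m F] cont_state_section[OF X m H]
      by (rule state_lipschitz[OF n], intro state_lipschitz[OF m] cont2_section_left[OF F] cont2_section_left[OF H])
        (auto simp: H_def approx)
    ultimately show ?thesis by linarith
  qed
  show ?thesis
  proof (rule ccontr)
    assume "\<not> ?thesis"
    \<comment> \<open>With a quarter of the gap as \<open>e\<close>, the bound \<open>2 * e\<close>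
      is only half the gap.\<close>
    then have "0 < \<bar>\<mu> (\<lambda>x. \<nu> (\<lambda>y. F x y)) - \<nu> (\<lambda>y. \<mu> (\<lambda>x. F x y))\<bar> / 4" by simp
    from *[OF this] this show False by simp
  qed
qed

subsection \<open>Hahn-Banach and lifting along surjections\<close>

text \<open>Homogeneity is required as an inequality only: this form passes directly to infima, and
  scaling back by \<open>1 / c\<close> recovers equality.\<close>

definition sublinear_on :: "('a \<Rightarrow> real) set \<Rightarrow> (('a \<Rightarrow> real) \<Rightarrow> real) \<Rightarrow> bool" where
  "sublinear_on S p \<longleftrightarrow>
     (\<forall>f\<in>S. \<forall>g\<in>S. p (\<lambda>x. f x + g x) \<le> p f + p g) \<and>
     (\<forall>f\<in>S. \<forall>c>0. p (\<lambda>x. c * f x) \<le> c * p f)"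

lemma sublinear_on_add:
  "sublinear_on S p \<Longrightarrow> f \<in> S \<Longrightarrow> g \<in> S \<Longrightarrow> p (\<lambda>x. f x + g x) \<le> p f + p g"
  by (simp add: sublinear_on_def)

context
  fixes S :: "('a \<Rightarrow> real) set"
  assumes S_add: "\<And>f g. f \<in> S \<Longrightarrow> g \<in> S \<Longrightarrow> (\<lambda>x. f x + g x) \<in> S"
    and S_cmult: "\<And>f c. f \<in> S \<Longrightarrow> (\<lambda>x. c * f x) \<in> S"
begin

lemma sublinear_on_cmult:
  assumes "sublinear_on S p" "f \<in> S" "0 < c"
  shows "p (\<lambda>x. c * f x) = c * p f"
proof (rule antisym)
  show "p (\<lambda>x. c * f x) \<le> c * p f" using assms by (simp add: sublinear_on_def)
  have "p (\<lambda>x. (1 / c) * (c * f x)) \<le> (1 / c) * p (\<lambda>x. c * f x)"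
    using assms S_cmult[OF assms(2), of c] unfolding sublinear_on_def by (auto simp del: times_divide_eq_left)
  then show "c * p f \<le> p (\<lambda>x. c * f x)" using assms(3) by (simp add: field_simps)
qed

lemma sublinear_on_0:
  assumes "sublinear_on S p" "f \<in> S"
  shows "p (\<lambda>x. 0) = 0"
  using sublinear_on_cmult[OF assms(1) S_cmult[OF assms(2), of 0], of 2] by simp

lemma sublinear_on_neg:
  assumes "sublinear_on S p" "f \<in> S"
  shows "- p (\<lambda>x. (-1) * f x) \<le> p f"
  using sublinear_on_add[OF assms S_cmult[OF assms(2), of "-1"]] sublinear_on_0[OF assms] by simp

text \<open>A minimal sublinear functional is linear: for each \<open>g\<close> the functional
  \<open>f \<mapsto> inf\<^sub>t (q (f + t g) - t q g)\<close> is sublinear and lies below \<open>q\<close>.\<close>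

lemma sublinear_on_minorant:
  assumes q: "sublinear_on S q" and g: "g \<in> S"
  defines "r \<equiv> \<lambda>f. INF t\<in>{0..}. q (\<lambda>x. f x + t * g x) - t * q g"
  shows "sublinear_on S r" "\<And>f t. f \<in> S \<Longrightarrow> 0 \<le> t \<Longrightarrow> r f \<le> q (\<lambda>x. f x + t * g x) - t * q g"
proof -
  have ft: "(\<lambda>x. f x + t * g x) \<in> S" if "f \<in> S" for f t using S_add S_cmult g that by blast
  have low: "- q (\<lambda>x. (-1) * f x) \<le> q (\<lambda>x. f x + t * g x) - t * q g" if f: "f \<in> S" and t: "0 \<le> t" for f t
  proof -
    have "q (\<lambda>x. (f x + t * g x) + (-1) * f x) \<le> q (\<lambda>x. f x + t * g x) + q (\<lambda>x. (-1) * f x)"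
      by (rule sublinear_on_add[OF q ft[OF f] S_cmult[OF f]])
    moreover have "q (\<lambda>x. t * g x) = t * q g"
      using sublinear_on_cmult[OF q g] sublinear_on_0[OF q g] t by (cases "t = 0") auto
    ultimately show ?thesis by simp
  qed
  show up: "r f \<le> q (\<lambda>x. f x + t * g x) - t * q g" if "f \<in> S" "0 \<le> t" for f t
    unfolding r_def
    by (rule cINF_lower2[of _ _ t]) (use that low in \<open>auto intro!: bdd_belowI2\<close>)
  have great: "c \<le> r f" if "\<And>t. 0 \<le> t \<Longrightarrow> c \<le> q (\<lambda>x. f x + t * g x) - t * q g" for c f
    unfolding r_def by (rule cINF_greatest) (use that in auto)
  have cm: "r (\<lambda>x. c * f x) \<le> c * r f" if f: "f \<in> S" and c: "0 < c" for f c
  proof -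
    have "r (\<lambda>x. c * f x) / c \<le> r f"
    proof (rule great)
      fix t :: real assume "0 \<le> t"
      then have "r (\<lambda>x. c * f x) \<le> q (\<lambda>x. c * f x + (c * t) * g x) - (c * t) * q g"
        using c by (intro up S_cmult f) auto
      also have "(\<lambda>x. c * f x + (c * t) * g x) = (\<lambda>x. c * (f x + t * g x))"
        by (simp add: algebra_simps)
      also have "q \<dots> = c * q (\<lambda>x. f x + t * g x)" by (rule sublinear_on_cmult[OF q ft[OF f] c])
      finally show "r (\<lambda>x. c * f x) / c \<le> q (\<lambda>x. f x + t * g x) - t * q g"
        using c by (simp add: field_simps)
    qed
    then show ?thesis using c by (simp add: field_simps)
  qed
  have "r (\<lambda>x. f x + h x) \<le> r f + r h" if f: "f \<in> S" and h: "h \<in> S" for f h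
  proof -
    have "r (\<lambda>x. f x + h x) - r h \<le> r f"
    proof (rule great)
      fix s :: real assume s: "0 \<le> s"
      have "r (\<lambda>x. f x + h x) - (q (\<lambda>x. f x + s * g x) - s * q g) \<le> r h"
      proof (rule great)
        fix t :: real assume t: "0 \<le> t"
        have "r (\<lambda>x. f x + h x) \<le> q (\<lambda>x. f x + h x + (s + t) * g x) - (s + t) * q g"
          using s t by (intro up S_add f h) auto
        also have "(\<lambda>x. f x + h x + (s + t) * g x) = (\<lambda>x. (f x + s * g x) + (h x + t * g x))"
          by (simp add: algebra_simps)
        also have "q \<dots> \<le> q (\<lambda>x. f x + s * g x) + q (\<lambda>x. h x + t * g x)"
          by (rule sublinear_on_add[OF q ft[OF f] ft[OF h]])
        finally show "r (\<lambda>x. f x + h x) - (q (\<lambda>x. f x + s * g x) - s * q g)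
            \<le> q (\<lambda>x. h x + t * g x) - t * q g"
          by (simp add: algebra_simps)
      qed
      then show "r (\<lambda>x. f x + h x) - r h \<le> q (\<lambda>x. f x + s * g x) - s * q g" by simp
    qed
    then show ?thesis by simp
  qed
  with cm show "sublinear_on S r" by (simp add: sublinear_on_def)
qed

text \<open>Zorn's lemma for the reversed pointwise order. A chain is bounded by its infimum, which
  is finite because no member drops below \<open>- p (\<lambda>x. (-1) * f x)\<close> at
  \<open>f\<close>.\<close>

lemma minimal_sublinear:
  assumes p: "sublinear_on S p"
  shows "\<exists>q. sublinear_on S q \<and> (\<forall>f\<in>S. q f \<le> p f) \<and>
    (\<forall>r. sublinear_on S r \<longrightarrow> (\<forall>f\<in>S. r f \<le> q f) \<longrightarrow> (\<forall>f\<in>S. r f = q f))"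
proof -
  \<comment> \<open>Values off \<open>S\<close> are pinned to 0: functionals are then compared on
    \<open>S\<close> alone, and the infimum of a chain is needed only there.\<close>
  define A where "A = {q. sublinear_on S q \<and> (\<forall>f\<in>S. q f \<le> p f) \<and> (\<forall>f. f \<notin> S \<longrightarrow> q f = 0)}"
  define P where "P q r \<longleftrightarrow> (\<forall>f. r f \<le> q f)" for q r :: "('a \<Rightarrow> real) \<Rightarrow> real"
  have sub_restrict: "sublinear_on S (\<lambda>f. if f \<in> S then q f else 0) \<longleftrightarrow> sublinear_on S q" for q
    unfolding sublinear_on_def using S_add S_cmult by auto
  have po: "partial_order_on A (relation_of P A)"
    by (rule partial_order_on_relation_ofI) (auto simp: P_def fun_eq_iff intro: order_trans antisym)
  have "\<exists>m\<in>A. \<forall>a\<in>A. P m a \<longrightarrow> a = m"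
  proof (rule predicate_Zorn[OF po])
    fix C assume C: "C \<in> Chains (relation_of P A)"
    then have CA: "C \<subseteq> A" by (auto simp: Chains_def relation_of_def)
    show "\<exists>u\<in>A. \<forall>a\<in>C. P a u"
    proof (cases "C = {}")
      case True
      have "(\<lambda>f. if f \<in> S then p f else 0) \<in> A" using p sub_restrict by (simp add: A_def)
      with True show ?thesis by blast
    next
      case False
      define u where "u f = (INF q\<in>C. q f)" for f
      have bdd: "bdd_below ((\<lambda>q. q f) ` C)" if f: "f \<in> S" for f
      proof (rule bdd_belowI2)
        fix q assume "q \<in> C"
        then have q: "sublinear_on S q" "\<forall>f\<in>S. q f \<le> p f" using CA by (auto simp: A_def)
        have "q (\<lambda>x. (-1) * f x) \<le> p (\<lambda>x. (-1) * f x)" using q(2) S_cmult[OF f] by blast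
        with sublinear_on_neg[OF q(1) f] show "- p (\<lambda>x. (-1) * f x) \<le> q f" by linarith
      qed
      have low: "u f \<le> q f" if "f \<in> S" "q \<in> C" for f q
        unfolding u_def by (rule cINF_lower[OF bdd]) (use that in auto)
      have great: "c \<le> u f" if "\<And>q. q \<in> C \<Longrightarrow> c \<le> q f" for c f
        unfolding u_def by (rule cINF_greatest[OF False]) (use that in auto)
      have "u (\<lambda>x. f x + g x) \<le> u f + u g" if f: "f \<in> S" and g: "g \<in> S" for f g
      proof -
        have "u (\<lambda>x. f x + g x) - u g \<le> u f"
        proof (rule great)
          fix q1 assume q1: "q1 \<in> C"
          have "u (\<lambda>x. f x + g x) - q1 f \<le> u g"
          proof (rule great)
            fix q2 assume q2: "q2 \<in> C"
            \<comment> \<open>Comparability yields one member of the chain below both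
              \<open>q1\<close> and \<open>q2\<close>, whose subadditivity handles the two choices
              at once.\<close>
            have "P q1 q2 \<or> P q2 q1" using C q1 q2 by (auto simp: Chains_def relation_of_def)
            then obtain q where q: "q \<in> C" "q f \<le> q1 f" "q g \<le> q2 g"
              using q1 q2 by (auto simp: P_def)
            have "u (\<lambda>x. f x + g x) \<le> q (\<lambda>x. f x + g x)" using low S_add f g q(1) by blast
            also have "\<dots> \<le> q f + q g" using q(1) CA by (intro sublinear_on_add[OF _ f g]) (auto simp: A_def)
            finally show "u (\<lambda>x. f x + g x) - q1 f \<le> q2 g" using q by linarith
          qed
          then show "u (\<lambda>x. f x + g x) - u g \<le> q1 f" by linarith
        qed
        then show ?thesis by linarith
      qed
      moreover have "u (\<lambda>x. c * f x) \<le> c * u f" if f: "f \<in> S" and c: "0 < c" for f c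
      proof -
        have "u (\<lambda>x. c * f x) / c \<le> u f"
        proof (rule great)
          fix q assume q: "q \<in> C"
          have "u (\<lambda>x. c * f x) \<le> q (\<lambda>x. c * f x)" using low S_cmult f q by blast
          also have "\<dots> = c * q f" using sublinear_on_cmult f q c CA by (auto simp: A_def)
          finally show "u (\<lambda>x. c * f x) / c \<le> q f" using c by (simp add: field_simps)
        qed
        then show ?thesis using c by (simp add: field_simps)
      qed
      ultimately have "sublinear_on S (\<lambda>f. if f \<in> S then u f else 0)"
        unfolding sub_restrict by (simp add: sublinear_on_def)
      moreover have "u f \<le> p f" if "f \<in> S" for f
        using False low[OF that] CA that by (force simp: A_def)
      ultimately have "(\<lambda>f. if f \<in> S then u f else 0) \<in> A" by (simp add: A_def)
      moreover have "P q (\<lambda>f. if f \<in> S then u f else 0)" if "q \<in> C" for q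
        using low that CA by (auto simp: P_def A_def)
      ultimately show ?thesis by blast
    qed
  qed
  then obtain q where q: "q \<in> A" "\<And>a. a \<in> A \<Longrightarrow> P q a \<Longrightarrow> a = q" by blast
  have "r f = q f" if r: "sublinear_on S r" "\<forall>f\<in>S. r f \<le> q f" and f: "f \<in> S" for r f
  proof -
    have "(\<lambda>f. if f \<in> S then r f else 0) = q"
    proof (rule q(2))
      show "(\<lambda>f. if f \<in> S then r f else 0) \<in> A"
        using r q(1) sub_restrict by (force simp: A_def)
      show "P q (\<lambda>f. if f \<in> S then r f else 0)" using r(2) q(1) by (auto simp: P_def A_def)
    qed
    from fun_cong[OF this, of f] f show ?thesis by simp
  qed
  then show ?thesis using q(1) by (intro exI[of _ q]) (auto simp: A_def)
qed

lemma Hahn_Banach_sublinear: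
  assumes p: "sublinear_on S p"
  shows "\<exists>L. (\<forall>f\<in>S. \<forall>g\<in>S. L (\<lambda>x. f x + g x) = L f + L g) \<and>
    (\<forall>f\<in>S. \<forall>c. L (\<lambda>x. c * f x) = c * L f) \<and> (\<forall>f\<in>S. L f \<le> p f)"
proof -
  obtain q where q: "sublinear_on S q" "\<And>f. f \<in> S \<Longrightarrow> q f \<le> p f"
    "\<And>r f. sublinear_on S r \<Longrightarrow> \<forall>f\<in>S. r f \<le> q f \<Longrightarrow> f \<in> S \<Longrightarrow> r f = q f"
    using minimal_sublinear[OF p] by blast
  have add: "q (\<lambda>x. f x + g x) = q f + q g" if f: "f \<in> S" and g: "g \<in> S" for f g
  proof (rule antisym)
    define r where "r f = (INF t\<in>{0..}. q (\<lambda>x. f x + t * g x) - t * q g)" for f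
    have r: "sublinear_on S r" "\<And>f t. f \<in> S \<Longrightarrow> 0 \<le> t \<Longrightarrow> r f \<le> q (\<lambda>x. f x + t * g x) - t * q g"
      unfolding r_def using sublinear_on_minorant[OF q(1) g] by blast+
    \<comment> \<open>\<open>t = 0\<close> puts \<open>r\<close> below \<open>q\<close>, so
      minimality gives \<open>r = q\<close>; then \<open>t = 1\<close> is the missing
      superadditivity.\<close>
    have "r f = q f" using r(2)[of _ 0] by (intro q(3)[OF r(1) _ f]) auto
    with r(2)[OF f, of 1] show "q f + q g \<le> q (\<lambda>x. f x + g x)" by simp
  qed (rule sublinear_on_add[OF q(1) f g])
  have "q (\<lambda>x. c * f x) = c * q f" if f: "f \<in> S" for c f
  proof -
    have neg: "q (\<lambda>x. - h x) = - q h" if "h \<in> S" for h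
      using add[OF that S_cmult[OF that, of "-1"]] sublinear_on_0[OF q(1) that] by simp
    consider "c = 0" | "0 < c" | "c < 0" by linarith
    then show ?thesis
    proof cases
      case 3
      have "q (\<lambda>x. c * f x) = q (\<lambda>x. - ((- c) * f x))" by simp
      also have "\<dots> = - q (\<lambda>x. (- c) * f x)" by (rule neg[OF S_cmult[OF f]])
      also have "q (\<lambda>x. (- c) * f x) = (- c) * q f" using 3 by (intro sublinear_on_cmult[OF q(1) f]) simp
      finally show ?thesis by simp
    qed (use sublinear_on_0[OF q(1) f] sublinear_on_cmult[OF q(1) f] in auto)
  qed
  with add q(2) show ?thesis by (intro exI[of _ q]) simp
qed

end

text \<open>Extends \<open>f \<circ> \<phi> \<mapsto> I f\<close> below the upper envelope \<open>a \<mapsto> inf {I f | a \<le> f \<circ> \<phi>}\<close>.\<close>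

lemma state_lift:
  assumes K: "compact_space K" and \<phi>: "continuous_map K L \<phi>" "\<phi> ` topspace K = topspace L"
    and I: "state L I"
  shows "\<exists>\<nu>. state K \<nu> \<and> (\<forall>f. cont L f \<longrightarrow> \<nu> (\<lambda>x. f (\<phi> x)) = I f)"
proof -
  define U where "U a = {f. cont L f \<and> (\<forall>x\<in>topspace K. a x \<le> f (\<phi> x))}" for a
  define p where "p a = (INF f\<in>U a. I f)" for a
  have ne: "U a \<noteq> {}" if a: "cont K a" for a
  proof -
    obtain M where M: "\<And>x. x \<in> topspace K \<Longrightarrow> \<bar>a x\<bar> \<le> M" using cont_bounded[OF K a] by blast
    have "(\<lambda>x. M) \<in> U a" unfolding U_def using M by (auto simp: abs_le_iff)
    then show ?thesis by blast
  qed
  have bdd: "bdd_below (I ` U a)" if a: "cont K a" for a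
  proof -
    obtain M where M: "\<And>x. x \<in> topspace K \<Longrightarrow> \<bar>a x\<bar> \<le> M" using cont_bounded[OF K a] by blast
    have "- M \<le> I f" if f: "f \<in> U a" for f
    proof (rule state_ge_const[OF I])
      show "cont L f" using f by (simp add: U_def)
      fix y assume "y \<in> topspace L"
      \<comment> \<open>Surjectivity carries the lower bound from \<open>K\<close> to every point of
        \<open>L\<close>, which keeps the infimum finite.\<close>
      then obtain x where x: "x \<in> topspace K" "y = \<phi> x" using \<phi>(2) by blast
      then have "a x \<le> f y" using f by (simp add: U_def)
      with M[OF x(1)] show "- M \<le> f y" by linarith
    qed
    then show ?thesis by (intro bdd_belowI2)
  qed
  have low: "p a \<le> I f" if "cont K a" "f \<in> U a" for a f
    unfolding p_def by (rule cINF_lower[OF bdd[OF that(1)] that(2)])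
  have great: "c \<le> p a" if "cont K a" "\<And>f. f \<in> U a \<Longrightarrow> c \<le> I f" for a c
    unfolding p_def by (rule cINF_greatest[OF ne[OF that(1)] that(2)])
  have "p (\<lambda>x. a x + b x) \<le> p a + p b" if a: "cont K a" and b: "cont K b" for a b
  proof -
    have "p (\<lambda>x. a x + b x) - p b \<le> p a"
    proof (rule great[OF a])
      fix f assume f: "f \<in> U a"
      have "p (\<lambda>x. a x + b x) - I f \<le> p b"
      proof (rule great[OF b])
        fix g assume g: "g \<in> U b"
        have "(\<lambda>x. f x + g x) \<in> U (\<lambda>x. a x + b x)"
          using f g by (auto simp: U_def intro: continuous_map_add add_mono)
        from low[OF continuous_map_add[OF a b] this] show "p (\<lambda>x. a x + b x) - I f \<le> I g"
          using state_add[OF I, of f g] f g by (simp add: U_def)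
      qed
      then show "p (\<lambda>x. a x + b x) - p b \<le> I f" by linarith
    qed
    then show ?thesis by linarith
  qed
  moreover have "p (\<lambda>x. c * a x) \<le> c * p a" if a: "cont K a" and c: "0 < c" for a c
  proof -
    have "p (\<lambda>x. c * a x) / c \<le> p a"
    proof (rule great[OF a])
      fix f assume f: "f \<in> U a"
      have "(\<lambda>x. c * f x) \<in> U (\<lambda>x. c * a x)"
        using f c by (auto simp: U_def intro: continuous_map_real_mult_left)
      from low[OF continuous_map_real_mult_left[OF a] this] show "p (\<lambda>x. c * a x) / c \<le> I f"
        using state_cmult[OF I, of f c] f c by (simp add: U_def field_simps)
    qed
    then show ?thesis using c by (simp add: field_simps)
  qed
  ultimately have "sublinear_on (Collect (cont K)) p" by (simp add: sublinear_on_def)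
  then obtain \<nu> where "\<forall>f\<in>Collect (cont K). \<forall>g\<in>Collect (cont K). \<nu> (\<lambda>x. f x + g x) = \<nu> f + \<nu> g"
    "\<forall>f\<in>Collect (cont K). \<forall>c. \<nu> (\<lambda>x. c * f x) = c * \<nu> f" "\<forall>f\<in>Collect (cont K). \<nu> f \<le> p f"
    using Hahn_Banach_sublinear[of "Collect (cont K)" p]
    by (auto simp: continuous_map_add continuous_map_real_mult_left)
  then have \<nu>: "\<And>f g. cont K f \<Longrightarrow> cont K g \<Longrightarrow> \<nu> (\<lambda>x. f x + g x) = \<nu> f + \<nu> g"
    "\<And>f c. cont K f \<Longrightarrow> \<nu> (\<lambda>x. c * f x) = c * \<nu> f" "\<And>f. cont K f \<Longrightarrow> \<nu> f \<le> p f" for f g c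
    by auto
  have comp: "cont K (\<lambda>x. f (\<phi> x))" if "cont L f" for f
    by (rule continuous_map_comp[OF that \<phi>(1)])
  have le: "\<nu> (\<lambda>x. f (\<phi> x)) \<le> I f" if f: "cont L f" for f
  proof -
    have "p (\<lambda>x. f (\<phi> x)) \<le> I f" using f by (intro low comp) (auto simp: U_def)
    with \<nu>(3)[OF comp[OF f]] show ?thesis by linarith
  qed
  have eq: "\<nu> (\<lambda>x. f (\<phi> x)) = I f" if f: "cont L f" for f
    using le[OF f] le[OF continuous_map_real_mult_left[OF f, of "-1"]]
    unfolding \<nu>(2)[OF comp[OF f]] state_cmult[OF I f] by linarith
  \<comment> \<open>For \<open>a \<ge> 0\<close> the zero function on \<open>L\<close> dominates
    \<open>- a\<close>, so the envelope at \<open>- a\<close> is at most 0. Positivity is thus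
    inherited from the envelope.\<close>
  have "0 \<le> \<nu> a" if a: "cont K a" "\<And>x. x \<in> topspace K \<Longrightarrow> 0 \<le> a x" for a
  proof -
    have "p (\<lambda>x. (-1) * a x) \<le> I (\<lambda>x. 0)"
      using a by (intro low) (auto simp: U_def continuous_map_minus)
    then show ?thesis
      using \<nu>(3)[OF continuous_map_real_mult_left[OF a(1), of "-1"]]
      unfolding \<nu>(2)[OF a(1)] state_const[OF I] by linarith
  qed
  then have "state K \<nu>"
    using \<nu>(1,2) eq[of "\<lambda>x. 1"] state_const[OF I] by (simp add: state_def)
  with eq show ?thesis by (intro exI[of _ \<nu>]) simp
qed

subsection \<open>The Haar integral of a compact group\<close>

lemma state_eval: "a \<in> topspace K \<Longrightarrow> state K (\<lambda>f. f a)"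
  by (simp add: state_def)

lemma state_pushforward:
  assumes "continuous_map K L \<phi>" "state K \<nu>"
  shows "state L (\<lambda>f. \<nu> (\<lambda>x. f (\<phi> x)))"
proof -
  have "cont K (\<lambda>x. f (\<phi> x))" if "cont L f" for f
    by (rule continuous_map_comp[OF that assms(1)])
  note comp = this
  have im: "\<phi> x \<in> topspace L" if "x \<in> topspace K" for x
    using continuous_map_image_subset_topspace[OF assms(1)] that by blast
  show ?thesis
    unfolding state_def
  proof (intro conjI allI impI)
    fix f g assume "cont L f" "cont L g"
    then show "\<nu> (\<lambda>x. f (\<phi> x) + g (\<phi> x)) = \<nu> (\<lambda>x. f (\<phi> x)) + \<nu> (\<lambda>x. g (\<phi> x))"
      by (intro state_add[OF assms(2)] comp)
  next
    fix c f assume "cont L f"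
    then show "\<nu> (\<lambda>x. c * f (\<phi> x)) = c * \<nu> (\<lambda>x. f (\<phi> x))"
      by (intro state_cmult[OF assms(2)] comp)
  next
    fix f assume f: "cont L f" "\<forall>y\<in>topspace L. 0 \<le> f y"
    show "0 \<le> \<nu> (\<lambda>x. f (\<phi> x))"
      by (rule state_nonneg[OF assms(2) comp[OF f(1)]]) (use f(2) im in blast)
  qed (rule state_const[OF assms(2)])
qed

lemma state_average:
  assumes "finite Z" "Z \<noteq> {}" "\<And>z. z \<in> Z \<Longrightarrow> state K (\<mu> z)"
  shows "state K (\<lambda>f. (\<Sum>z\<in>Z. \<mu> z f) / real (card Z))"
  unfolding state_def
proof (intro conjI allI impI)
  fix f g assume "cont K f" "cont K g"
  then have "(\<Sum>z\<in>Z. \<mu> z (\<lambda>x. f x + g x)) = (\<Sum>z\<in>Z. \<mu> z f + \<mu> z g)"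
    by (intro sum.cong refl state_add[OF assms(3)])
  then show "(\<Sum>z\<in>Z. \<mu> z (\<lambda>x. f x + g x)) / real (card Z) =
      (\<Sum>z\<in>Z. \<mu> z f) / real (card Z) + (\<Sum>z\<in>Z. \<mu> z g) / real (card Z)"
    by (simp add: sum.distrib add_divide_distrib)
next
  fix c f assume "cont K f"
  then have "(\<Sum>z\<in>Z. \<mu> z (\<lambda>x. c * f x)) = (\<Sum>z\<in>Z. c * \<mu> z f)"
    by (intro sum.cong refl state_cmult[OF assms(3)])
  then show "(\<Sum>z\<in>Z. \<mu> z (\<lambda>x. c * f x)) / real (card Z) = c * ((\<Sum>z\<in>Z. \<mu> z f) / real (card Z))"
    by (simp add: sum_distrib_left)
next
  fix f assume "cont K f" "\<forall>x\<in>topspace K. 0 \<le> f x"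
  then show "0 \<le> (\<Sum>z\<in>Z. \<mu> z f) / real (card Z)"
    by (intro divide_nonneg_nonneg sum_nonneg state_nonneg[OF assms(3)]) auto
next
  have "(\<Sum>z\<in>Z. \<mu> z (\<lambda>x. 1)) = (\<Sum>z\<in>Z. 1)"
    by (intro sum.cong refl state_const[OF assms(3)])
  then show "(\<Sum>z\<in>Z. \<mu> z (\<lambda>x. 1)) / real (card Z) = 1" using assms(1,2) by simp
qed

locale compact_group = group G for G (structure) +
  fixes T
  assumes topspace_eq: "topspace T = carrier G"
    and compact: "compact_space T"
    and mult: "continuous_map (prod_topology T T) T (\<lambda>p. fst p \<otimes> snd p)"
    and inverse: "continuous_map T T (\<lambda>x. inv x)"
begin

lemma cont_mult:
  assumes "continuous_map Z T f" "continuous_map Z T g"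
  shows "continuous_map Z T (\<lambda>z. f z \<otimes> g z)"
proof -
  have "continuous_map Z (prod_topology T T) (\<lambda>z. (f z, g z))"
    using assms by (simp add: continuous_map_paired)
  from continuous_map_comp[OF mult this] show ?thesis by simp
qed

lemma cont_inv: "continuous_map Z T f \<Longrightarrow> continuous_map Z T (\<lambda>z. inv (f z))"
  by (rule continuous_map_comp[OF inverse])

lemma cont_const: "g \<in> carrier G \<Longrightarrow> continuous_map Z T (\<lambda>z. g)"
  by (simp add: topspace_eq)

lemma cont_id: "continuous_map T T (\<lambda>x. x)"
  by simp

lemmas group_cont = cont_mult cont_inv cont_const cont_id continuous_map_fst continuous_map_snd

lemma cont_right_translate:
  assumes f: "cont T f" and g: "g \<in> carrier G"
  shows "cont T (\<lambda>x. f (x \<otimes> g))"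
  by (rule continuous_map_comp[OF f]) (intro group_cont g)

lemma cont_inv_arg:
  assumes f: "cont T f"
  shows "cont T (\<lambda>x. f (inv x))"
  by (rule continuous_map_comp[OF f]) (intro group_cont)

lemma cont2_mult:
  assumes f: "cont T f"
  shows "cont2 T T (\<lambda>x y. f (x \<otimes> y))"
  by (rule continuous_map_comp[OF f]) (intro group_cont)

lemma cont2_mult_swap:
  assumes f: "cont T f"
  shows "cont2 T T (\<lambda>x y. f (y \<otimes> x))"
  by (rule continuous_map_comp[OF f]) (intro group_cont)

text \<open>Moving a finite net \<open>Z\<close> to \<open>x\<^sub>0\<close>: every \<open>x\<close> is carried near \<open>x\<^sub>0\<close> by some
  left translation \<open>x\<^sub>0 z\<inverse>\<close>.\<close>

lemma translation_net:
  assumes f: "cont T f" and e: "0 < e"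
  obtains Z where "finite Z" "Z \<noteq> {}" "Z \<subseteq> carrier G"
    "\<And>x x0. x \<in> carrier G \<Longrightarrow> x0 \<in> carrier G \<Longrightarrow>
       \<exists>z\<in>Z. \<forall>y\<in>carrier G. \<bar>f (y \<otimes> (x0 \<otimes> inv z \<otimes> x)) - f (y \<otimes> x0)\<bar> < e"
proof -
  obtain Z where Z: "finite Z" "Z \<subseteq> carrier G"
    and net: "\<And>x. x \<in> carrier G \<Longrightarrow> \<exists>z\<in>Z. \<forall>y\<in>carrier G. \<bar>f (y \<otimes> x) - f (y \<otimes> z)\<bar> < e"
    using compact_uniform_net[OF compact compact cont2_mult[OF f] e] unfolding topspace_eq by auto
  have ne: "Z \<noteq> {}" using net[OF one_closed] by blast
  have near: "\<exists>z\<in>Z. \<forall>y\<in>carrier G. \<bar>f (y \<otimes> (x0 \<otimes> inv z \<otimes> x)) - f (y \<otimes> x0)\<bar> < e"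
    if x: "x \<in> carrier G" and x0: "x0 \<in> carrier G" for x x0
  proof -
    obtain z where z: "z \<in> Z" "\<forall>y\<in>carrier G. \<bar>f (y \<otimes> x) - f (y \<otimes> z)\<bar> < e" using net[OF x] by blast
    then have zc: "z \<in> carrier G" using Z by blast
    have "\<bar>f (y \<otimes> (x0 \<otimes> inv z \<otimes> x)) - f (y \<otimes> x0)\<bar> < e" if y: "y \<in> carrier G" for y
    proof -
      have "y \<otimes> x0 \<otimes> inv z \<in> carrier G" using x0 y zc by simp
      with z(2) have "\<bar>f (y \<otimes> x0 \<otimes> inv z \<otimes> x) - f (y \<otimes> x0 \<otimes> inv z \<otimes> z)\<bar> < e" by blast
      then show ?thesis using x x0 y zc by (simp add: m_assoc)
    qed
    with z(1) show ?thesis by blast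
  qed
  show ?thesis by (rule that[OF Z(1) ne Z(2) near])
qed

text \<open>Von Neumann's finite convex combinations of translates are relaxed to averages against
  an arbitrary state. Iterated averages are then again averages, and Fubini for states applies to
  them.\<close>

definition lnear :: "real \<Rightarrow> ('a \<Rightarrow> real) \<Rightarrow> real \<Rightarrow> bool" where
  "lnear e f c \<longleftrightarrow> (\<exists>\<mu>. state T \<mu> \<and> (\<forall>x\<in>carrier G. \<bar>\<mu> (\<lambda>y. f (y \<otimes> x)) - c\<bar> \<le> e))"

definition rnear :: "real \<Rightarrow> ('a \<Rightarrow> real) \<Rightarrow> real \<Rightarrow> bool" where
  "rnear e f c \<longleftrightarrow> (\<exists>\<mu>. state T \<mu> \<and> (\<forall>x\<in>carrier G. \<bar>\<mu> (\<lambda>y. f (x \<otimes> y)) - c\<bar> \<le> e))"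

text \<open>If the average \<open>A\<close> of \<open>f\<close> lies in \<open>[a, a + w]\<close> and \<open>A x\<^sub>0\<close> is in the lower half, then averaging the
  translates of \<open>A\<close> by \<open>x\<^sub>0 z\<inverse>\<close> lowers the maximum, since at every point one of the \<open>card Z\<close>
  translates is within \<open>e\<close> of \<open>A x\<^sub>0\<close>.\<close>

lemma lnear_contraction:
  assumes f: "cont T f" and Z: "finite Z" "Z \<noteq> {}" "Z \<subseteq> carrier G" and e: "0 \<le> e"
    and net: "\<And>x x0. x \<in> carrier G \<Longrightarrow> x0 \<in> carrier G \<Longrightarrow>
       \<exists>z\<in>Z. \<forall>y\<in>carrier G. \<bar>f (y \<otimes> (x0 \<otimes> inv z \<otimes> x)) - f (y \<otimes> x0)\<bar> < e"
    and \<mu>: "state T \<mu>" and w: "0 \<le> w"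
    and osc: "\<And>x. x \<in> carrier G \<Longrightarrow> a \<le> \<mu> (\<lambda>y. f (y \<otimes> x)) \<and> \<mu> (\<lambda>y. f (y \<otimes> x)) \<le> a + w"
  shows "\<exists>\<mu>' a'. state T \<mu>' \<and> (\<forall>x\<in>carrier G. a' \<le> \<mu>' (\<lambda>y. f (y \<otimes> x)) \<and>
    \<mu>' (\<lambda>y. f (y \<otimes> x)) \<le> a' + ((1 - 1 / (2 * real (card Z))) * w + e / real (card Z)))"
proof -
  define n where "n = real (card Z)"
  define A where "A x = \<mu> (\<lambda>y. f (y \<otimes> x))" for x
  have n: "1 \<le> n" using Z(1,2) by (simp add: n_def Suc_leI card_gt_0_iff)
  show ?thesis
  proof (cases "\<exists>x0\<in>carrier G. A x0 \<le> a + w / 2")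
    \<comment> \<open>Without a low point the same \<open>\<mu>\<close> works, with \<open>a\<close>
      raised to the midpoint.\<close>
    case False
    have "w / 2 \<le> (1 - 1 / (2 * n)) * w" using n w mult_right_mono[of 1 n w] by (simp add: field_simps)
    moreover have "0 \<le> e / n" using e n by simp
    ultimately have "a + w / 2 \<le> A x \<and> A x \<le> (a + w / 2) + ((1 - 1 / (2 * n)) * w + e / n)"
      if "x \<in> carrier G" for x
      using osc[OF that] False that by (fastforce simp: A_def)
    with \<mu> show ?thesis unfolding A_def n_def by blast
  next
    case True
    then obtain x0 where x0: "x0 \<in> carrier G" "A x0 \<le> a + w / 2" by blast
    define g where "g z = x0 \<otimes> inv z" for z
    have g: "g z \<in> carrier G" if "z \<in> Z" for z using that Z(3) x0(1) by (auto simp: g_def)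
    define \<mu>' where "\<mu>' h = (\<Sum>z\<in>Z. \<mu> (\<lambda>y. h (y \<otimes> g z))) / n" for h
    have "state T \<mu>'"
      unfolding \<mu>'_def n_def
      by (intro state_average Z state_pushforward[OF _ \<mu>] cont_mult cont_id cont_const g)
    moreover have "a \<le> \<mu>' (\<lambda>y. f (y \<otimes> x)) \<and> \<mu>' (\<lambda>y. f (y \<otimes> x)) \<le> a + ((1 - 1 / (2 * n)) * w + e / n)"
      if x: "x \<in> carrier G" for x
    proof -
      have "\<mu> (\<lambda>y. f (y \<otimes> g z \<otimes> x)) = A (g z \<otimes> x)" if z: "z \<in> Z" for z
        unfolding A_def
        by (rule state_cong[OF \<mu>])
          (use g[OF z] x in \<open>auto simp: topspace_eq m_assoc intro!: continuous_map_comp[OF f] group_cont\<close>)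
      then have eq: "\<mu>' (\<lambda>y. f (y \<otimes> x)) * n = (\<Sum>z\<in>Z. A (g z \<otimes> x))"
        using n by (simp add: \<mu>'_def)
      have lo: "a \<le> A (g z \<otimes> x)" and hi: "A (g z \<otimes> x) \<le> a + w" if "z \<in> Z" for z
        using osc[of "g z \<otimes> x"] g[OF that] x by (auto simp: A_def)
      have "n * a \<le> (\<Sum>z\<in>Z. A (g z \<otimes> x))"
        using sum_bounded_below[of Z a "\<lambda>z. A (g z \<otimes> x)"] lo by (simp add: n_def)
      then have "a * n \<le> \<mu>' (\<lambda>y. f (y \<otimes> x)) * n"
        unfolding eq by (simp add: mult.commute)
      then have 1: "a \<le> \<mu>' (\<lambda>y. f (y \<otimes> x))"
        by (rule mult_right_le_imp_le) (use n in simp)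
      obtain z where z: "z \<in> Z" "\<forall>y\<in>carrier G. \<bar>f (y \<otimes> (g z \<otimes> x)) - f (y \<otimes> x0)\<bar> < e"
        using net[OF x x0(1)] unfolding g_def by blast
      have "\<bar>A (g z \<otimes> x) - A x0\<bar> \<le> e"
        unfolding A_def using z g[OF z(1)] x x0(1)
        by (intro state_lipschitz[OF \<mu>] cont_right_translate f) (auto simp: topspace_eq intro: less_imp_le)
      \<comment> \<open>One of the \<open>n\<close> summands falls short of \<open>a + w\<close> by
        \<open>w / 2 - e\<close>, so their mean falls short by \<open>(w / 2 - e) / n\<close>; both
        terms of the new width come from here.\<close>
      then have "A (g z \<otimes> x) \<le> a + w - (w / 2 - e)" using x0(2) by linarith
      moreover have "(\<Sum>z\<in>Z - {z}. A (g z \<otimes> x)) \<le> real (card (Z - {z})) * (a + w)"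
        using sum_bounded_above[of "Z - {z}" "\<lambda>z. A (g z \<otimes> x)" "a + w"] hi by simp
      moreover have "real (card (Z - {z})) = n - 1"
        using z(1) Z(1) n by (simp add: n_def card_Diff_singleton of_nat_diff)
      ultimately have "(\<Sum>z\<in>Z. A (g z \<otimes> x)) \<le> n * (a + w) - (w / 2 - e)"
        using sum.remove[OF Z(1) z(1), of "\<lambda>z. A (g z \<otimes> x)"] by (simp add: algebra_simps)
      moreover have expand: "(a + ((1 - 1 / (2 * n)) * w + e / n)) * n = n * (a + w) - (w / 2 - e)"
        using n by (simp add: field_simps)
      ultimately have "\<mu>' (\<lambda>y. f (y \<otimes> x)) * n \<le> (a + ((1 - 1 / (2 * n)) * w + e / n)) * n"
        unfolding eq by simp
      then have "\<mu>' (\<lambda>y. f (y \<otimes> x)) \<le> a + ((1 - 1 / (2 * n)) * w + e / n)"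
        by (rule mult_right_le_imp_le) (use n in simp)
      with 1 show ?thesis by blast
    qed
    ultimately show ?thesis unfolding n_def by blast
  qed
qed

text \<open>The net \<open>Z\<close> depends on \<open>f\<close> and the tolerance but not on the
  current average, so the contraction can be iterated with one fixed ratio
  \<open>r < 1\<close>.\<close>

lemma lnear_exists:
  assumes f: "cont T f" and e: "0 < e"
  shows "\<exists>c. lnear e f c"
proof -
  \<comment> \<open>The width recursion \<open>w \<mapsto> r * w + d / n\<close> has fixed point
    \<open>2 * d\<close>, which uses up two thirds of \<open>e\<close>; the last third absorbs the
    decaying part \<open>r ^ k * (2 * M)\<close>.\<close>
  define d where "d = e / 3"
  have d: "0 < d" using e by (simp add: d_def)
  obtain Z where Z: "finite Z" "Z \<noteq> {}" "Z \<subseteq> carrier G"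
    and net: "\<And>x x0. x \<in> carrier G \<Longrightarrow> x0 \<in> carrier G \<Longrightarrow>
       \<exists>z\<in>Z. \<forall>y\<in>carrier G. \<bar>f (y \<otimes> (x0 \<otimes> inv z \<otimes> x)) - f (y \<otimes> x0)\<bar> < d"
    using translation_net[OF f d] by blast
  obtain M where M: "0 \<le> M" "\<And>x. x \<in> carrier G \<Longrightarrow> \<bar>f x\<bar> \<le> M"
    using cont_bounded[OF compact f] unfolding topspace_eq by blast
  define n where "n = real (card Z)"
  have n: "1 \<le> n" using Z(1,2) by (simp add: n_def Suc_leI card_gt_0_iff)
  define r where "r = 1 - 1 / (2 * n)"
  have r: "0 \<le> r" "r < 1" using n by (auto simp: r_def field_simps)
  have iter: "\<exists>\<mu> a. state T \<mu> \<and> (\<forall>x\<in>carrier G. a \<le> \<mu> (\<lambda>y. f (y \<otimes> x)) \<and>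
      \<mu> (\<lambda>y. f (y \<otimes> x)) \<le> a + (2 * d + r ^ k * (2 * M)))" for k
  proof (induction k)
    case 0
    have "- M \<le> f (\<one> \<otimes> x) \<and> f (\<one> \<otimes> x) \<le> - M + (2 * d + r ^ 0 * (2 * M))" if "x \<in> carrier G" for x
      using M(2)[OF that] d that by (simp add: abs_le_iff)
    moreover have "state T (\<lambda>f. f \<one>)" by (rule state_eval) (simp add: topspace_eq)
    ultimately show ?case by (intro exI[of _ "\<lambda>f. f \<one>"] exI[of _ "- M"]) blast
  next
    case (Suc k)
    define w where "w = 2 * d + r ^ k * (2 * M)"
    have "0 \<le> w" using d r M by (simp add: w_def)
    obtain \<mu> a where \<mu>: "state T \<mu>" "\<And>x. x \<in> carrier G \<Longrightarrow> a \<le> \<mu> (\<lambda>y. f (y \<otimes> x)) \<and>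
        \<mu> (\<lambda>y. f (y \<otimes> x)) \<le> a + w"
      using Suc unfolding w_def by blast
    have "\<exists>\<mu> a. state T \<mu> \<and> (\<forall>x\<in>carrier G. a \<le> \<mu> (\<lambda>y. f (y \<otimes> x)) \<and>
        \<mu> (\<lambda>y. f (y \<otimes> x)) \<le> a + (r * w + d / n))"
      unfolding r_def n_def
    proof (rule lnear_contraction[where a = a, OF f Z less_imp_le[OF d] _ \<mu>(1) \<open>0 \<le> w\<close>], goal_cases)
      case 1
      then show ?case by (rule net)
    next
      case 2
      then show ?case by (rule \<mu>(2))
    qed
    moreover have "r * w + d / n = 2 * d + r ^ Suc k * (2 * M)"
      using n by (simp add: w_def r_def field_simps)
    ultimately show ?case by simp
  qed
  \<comment> \<open>\<open>2 * M + 1\<close> instead of \<open>2 * M\<close>, since \<open>M\<close>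
    may be 0.\<close>
  have "0 < d / (2 * M + 1)" using d M by simp
  then obtain k where "r ^ k < d / (2 * M + 1)" using real_arch_pow_inv[OF _ r(2)] by blast
  then have "r ^ k * (2 * M + 1) < d" using M by (simp add: field_simps)
  moreover have "0 \<le> r ^ k" using r by simp
  ultimately have "r ^ k * (2 * M) \<le> d" by (simp add: distrib_left)
  moreover obtain \<mu> a where "state T \<mu>" "\<forall>x\<in>carrier G. a \<le> \<mu> (\<lambda>y. f (y \<otimes> x)) \<and>
      \<mu> (\<lambda>y. f (y \<otimes> x)) \<le> a + (2 * d + r ^ k * (2 * M))" using iter[of k] by blast
  ultimately show ?thesis
    unfolding lnear_def by (intro exI[of _ a] exI[of _ \<mu>]) (force simp: d_def abs_le_iff)
qed

text \<open>Inversion turns \<open>y \<otimes> x\<close> into \<open>inv x \<otimes> inv y\<close>,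
  so pushing the state forward under inversion exchanges left and right translates.\<close>

lemma rnear_of_lnear_inv:
  assumes f: "cont T f" and near: "lnear e (\<lambda>x. f (inv x)) c"
  shows "rnear e f c"
proof -
  obtain \<mu> where \<mu>: "state T \<mu>" "\<And>x. x \<in> carrier G \<Longrightarrow> \<bar>\<mu> (\<lambda>y. f (inv (y \<otimes> x))) - c\<bar> \<le> e"
    using near unfolding lnear_def by blast
  have "\<mu> (\<lambda>y. f (x \<otimes> inv y)) = \<mu> (\<lambda>y. f (inv (y \<otimes> inv x)))" if x: "x \<in> carrier G" for x
    by (rule state_cong[OF \<mu>(1)])
      (use x in \<open>auto simp: topspace_eq inv_mult_group intro!: continuous_map_comp[OF f] group_cont\<close>)
  then have "\<bar>\<mu> (\<lambda>y. f (x \<otimes> inv y)) - c\<bar> \<le> e" if "x \<in> carrier G" for x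
    using \<mu>(2)[of "inv x"] that by simp
  moreover have "state T (\<lambda>h. \<mu> (\<lambda>y. h (inv y)))"
    by (rule state_pushforward[OF inverse \<mu>(1)])
  ultimately show ?thesis unfolding rnear_def by (intro exI[of _ "\<lambda>h. \<mu> (\<lambda>y. h (inv y))"]) simp
qed

lemma lnear_of_rnear_inv:
  assumes f: "cont T f" and near: "rnear e (\<lambda>x. f (inv x)) c"
  shows "lnear e f c"
proof -
  obtain \<mu> where \<mu>: "state T \<mu>" "\<And>x. x \<in> carrier G \<Longrightarrow> \<bar>\<mu> (\<lambda>y. f (inv (x \<otimes> y))) - c\<bar> \<le> e"
    using near unfolding rnear_def by blast
  have "\<mu> (\<lambda>y. f (inv y \<otimes> x)) = \<mu> (\<lambda>y. f (inv (inv x \<otimes> y)))" if x: "x \<in> carrier G" for x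
    by (rule state_cong[OF \<mu>(1)])
      (use x in \<open>auto simp: topspace_eq inv_mult_group intro!: continuous_map_comp[OF f] group_cont\<close>)
  then have "\<bar>\<mu> (\<lambda>y. f (inv y \<otimes> x)) - c\<bar> \<le> e" if "x \<in> carrier G" for x
    using \<mu>(2)[of "inv x"] that by simp
  moreover have "state T (\<lambda>h. \<mu> (\<lambda>y. h (inv y)))"
    by (rule state_pushforward[OF inverse \<mu>(1)])
  ultimately show ?thesis unfolding lnear_def by (intro exI[of _ "\<lambda>h. \<mu> (\<lambda>y. h (inv y))"]) simp
qed

lemma rnear_exists: "cont T f \<Longrightarrow> 0 < e \<Longrightarrow> \<exists>c. rnear e f c"
  using lnear_exists[OF cont_inv_arg] rnear_of_lnear_inv by metis

lemma lnear_mono: "lnear e f c \<Longrightarrow> e + \<bar>c - c'\<bar> \<le> e' \<Longrightarrow> lnear e' f c'"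
  unfolding lnear_def by (elim exE conjE, rule exI, rule conjI, assumption) (force simp: abs_le_iff)

lemma rnear_mono: "rnear e f c \<Longrightarrow> e + \<bar>c - c'\<bar> \<le> e' \<Longrightarrow> rnear e' f c'"
  unfolding rnear_def by (elim exE conjE, rule exI, rule conjI, assumption) (force simp: abs_le_iff)

text \<open>Averaging \<open>f (y \<otimes> z)\<close> over both variables gives a number close to
  \<open>d\<close> in one order and close to \<open>c\<close> in the other, and Fubini identifies
  the two.\<close>

lemma lnear_rnear_dist:
  assumes f: "cont T f" and l: "lnear e f c" and r: "rnear e' f d"
  shows "\<bar>c - d\<bar> \<le> e + e'"
proof -
  obtain \<mu> where \<mu>: "state T \<mu>" "\<And>x. x \<in> carrier G \<Longrightarrow> \<bar>\<mu> (\<lambda>y. f (y \<otimes> x)) - c\<bar> \<le> e"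
    using l unfolding lnear_def by blast
  obtain \<nu> where \<nu>: "state T \<nu>" "\<And>x. x \<in> carrier G \<Longrightarrow> \<bar>\<nu> (\<lambda>y. f (x \<otimes> y)) - d\<bar> \<le> e'"
    using r unfolding rnear_def by blast
  have "\<bar>\<mu> (\<lambda>y. \<nu> (\<lambda>z. f (y \<otimes> z))) - \<mu> (\<lambda>y. d)\<bar> \<le> e'"
    by (intro state_lipschitz[OF \<mu>(1)] cont_state_section[OF compact \<nu>(1)] cont2_mult_swap f)
      (auto simp: topspace_eq \<nu>(2))
  moreover have "\<bar>\<nu> (\<lambda>z. \<mu> (\<lambda>y. f (y \<otimes> z))) - \<nu> (\<lambda>z. c)\<bar> \<le> e"
    by (intro state_lipschitz[OF \<nu>(1)] cont_state_section[OF compact \<mu>(1)] cont2_mult f)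
      (auto simp: topspace_eq \<mu>(2))
  moreover have "\<mu> (\<lambda>y. \<nu> (\<lambda>z. f (y \<otimes> z))) = \<nu> (\<lambda>z. \<mu> (\<lambda>y. f (y \<otimes> z)))"
    by (rule state_Fubini[OF compact compact \<mu>(1) \<nu>(1) cont2_mult[OF f]])
  ultimately show ?thesis by (simp add: state_const[OF \<mu>(1)] state_const[OF \<nu>(1)])
qed

lemma mean_exists:
  assumes f: "cont T f"
  shows "\<exists>c. \<forall>e>0. lnear e f c \<and> rnear e f c"
proof -
  define s where "s n = 1 / real (Suc n)" for n
  have s: "0 < s n" for n by (simp add: s_def)
  obtain c where c: "\<And>n. lnear (s n) f (c n)" using lnear_exists[OF f s] by metis
  obtain d where d: "\<And>n. rnear (s n) f (d n)" using rnear_exists[OF f s] by metis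
  have cd: "\<bar>c n - d m\<bar> \<le> s n + s m" for n m by (rule lnear_rnear_dist[OF f c d])
  \<comment> \<open>Every \<open>c n - s n\<close> is at most every \<open>d k + s k\<close>, so
    this supremum separates the two families and serves as their common limit.\<close>
  define m where "m = (SUP n. c n - s n)"
  have "c n - s n \<le> d k + s k" for n k using cd[of n k] by linarith
  then have up: "m \<le> d k + s k" for k unfolding m_def by (intro cSUP_least) auto
  have lo: "c n - s n \<le> m" for n
    unfolding m_def
  proof (rule cSUP_upper)
    show "bdd_above (range (\<lambda>n. c n - s n))"
      using \<open>\<And>n k. c n - s n \<le> d k + s k\<close>[of _ 0] by (intro bdd_aboveI2)
  qed simp
  have "lnear e f m \<and> rnear e f m" if e: "0 < e" for e
  proof -
    \<comment> \<open>Both \<open>c n\<close> and \<open>d n\<close> lie within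
      \<open>3 * s n\<close> of \<open>m\<close>, and each mean has its own error
      \<open>s n\<close>: four times \<open>s n\<close> in total.\<close>
    obtain n where n: "s n < e / 4" using e reals_Archimedean[of "e / 4"] by (auto simp: s_def inverse_eq_divide)
    have "\<bar>c n - m\<bar> \<le> 3 * s n" "\<bar>d n - m\<bar> \<le> 3 * s n" using cd[of n n] up[of n] lo[of n] s[of n] by linarith+
    then show ?thesis
      using n by (intro conjI lnear_mono[OF c[of n]] rnear_mono[OF d[of n]]) auto
  qed
  then show ?thesis by blast
qed

section \<open>Linearity, invariance and faithfulness of the mean\<close>

definition haar :: "('a \<Rightarrow> real) \<Rightarrow> real" where
  "haar f = (SOME c. \<forall>e>0. lnear e f c \<and> rnear e f c)"

lemma haar_near:
  assumes "cont T f" "0 < e"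
  shows "lnear e f (haar f)" "rnear e f (haar f)"
  using someI_ex[OF mean_exists[OF assms(1)]] assms(2) unfolding haar_def by blast+

text \<open>Left means alone suffice: they are compared with the right means that
  \<open>haar f\<close> already has, and tolerances of a third of the gap contradict a nonzero
  gap.\<close>

lemma haar_eqI_left:
  assumes f: "cont T f" and near: "\<And>e. 0 < e \<Longrightarrow> lnear e f c"
  shows "haar f = c"
proof (rule ccontr)
  assume "haar f \<noteq> c"
  then have pos: "0 < \<bar>c - haar f\<bar> / 3" by simp
  from lnear_rnear_dist[OF f near[OF pos] haar_near(2)[OF f pos]] pos show False by simp
qed

lemma haar_eqI_right:
  assumes f: "cont T f" and near: "\<And>e. 0 < e \<Longrightarrow> rnear e f c"
  shows "haar f = c"
proof (rule ccontr)
  assume "haar f \<noteq> c"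
  then have pos: "0 < \<bar>haar f - c\<bar> / 3" by simp
  from lnear_rnear_dist[OF f haar_near(1)[OF f pos] near[OF pos]] pos show False by simp
qed

lemma cont_left_average: "state T \<mu> \<Longrightarrow> cont T f \<Longrightarrow> cont T (\<lambda>x. \<mu> (\<lambda>y. f (y \<otimes> x)))"
  by (rule cont_state_section[OF compact _ cont2_mult])

text \<open>Right averages commute with left ones by Fubini, so a state that flattens
  \<open>f\<close> from the right flattens every left average of \<open>f\<close> to the same
  constant.\<close>

lemma haar_left_average:
  assumes \<mu>: "state T \<mu>" and f: "cont T f"
  shows "haar (\<lambda>x. \<mu> (\<lambda>y. f (y \<otimes> x))) = haar f"
proof (rule haar_eqI_right[OF cont_left_average[OF \<mu> f]])
  fix e :: real assume "0 < e"
  then obtain \<nu> where \<nu>: "state T \<nu>" "\<And>x. x \<in> carrier G \<Longrightarrow> \<bar>\<nu> (\<lambda>z. f (x \<otimes> z)) - haar f\<bar> \<le> e"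
    using haar_near(2)[OF f] unfolding rnear_def by blast
  have "\<bar>\<nu> (\<lambda>z. \<mu> (\<lambda>y. f (y \<otimes> (x \<otimes> z)))) - haar f\<bar> \<le> e" if x: "x \<in> carrier G" for x
  proof -
    have c: "cont2 T T (\<lambda>z y. f (y \<otimes> (x \<otimes> z)))"
      by (rule continuous_map_comp[OF f]) (intro group_cont x)
    have "\<nu> (\<lambda>z. \<mu> (\<lambda>y. f (y \<otimes> (x \<otimes> z)))) = \<mu> (\<lambda>y. \<nu> (\<lambda>z. f (y \<otimes> (x \<otimes> z))))"
      by (rule state_Fubini[OF compact compact \<nu>(1) \<mu> c])
    moreover have "\<bar>\<nu> (\<lambda>z. f (y \<otimes> (x \<otimes> z))) - haar f\<bar> \<le> e" if y: "y \<in> carrier G" for y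
    proof -
      have "\<nu> (\<lambda>z. f (y \<otimes> (x \<otimes> z))) = \<nu> (\<lambda>z. f (y \<otimes> x \<otimes> z))"
        by (rule state_cong[OF \<nu>(1)])
          (use x y in \<open>auto simp: topspace_eq m_assoc intro!: continuous_map_comp[OF f] group_cont\<close>)
      then show ?thesis using \<nu>(2)[of "y \<otimes> x"] x y by simp
    qed
    then have "\<bar>\<mu> (\<lambda>y. \<nu> (\<lambda>z. f (y \<otimes> (x \<otimes> z)))) - \<mu> (\<lambda>y. haar f)\<bar> \<le> e"
      by (intro state_lipschitz[OF \<mu>] cont_state_section[OF compact \<nu>(1) c]) (auto simp: topspace_eq)
    ultimately show ?thesis by (simp add: state_const[OF \<mu>])
  qed
  with \<nu>(1) show "rnear e (\<lambda>x. \<mu> (\<lambda>y. f (y \<otimes> x))) (haar f)" unfolding rnear_def by blast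
qed

text \<open>The two functions are flattened by different states. The remedy is to average by the
  \<open>\<mu>\<close> of \<open>f\<close> first and to choose \<open>\<nu>\<close> for the averaged
  \<open>g\<close>, whose mean is still \<open>haar g\<close>; the averaged \<open>f\<close>,
  already nearly constant, stays so under \<open>\<nu>\<close>.\<close>

lemma haar_add:
  assumes f: "cont T f" and g: "cont T g"
  shows "haar (\<lambda>x. f x + g x) = haar f + haar g"
proof (rule haar_eqI_left[OF continuous_map_add[OF f g]])
  fix e :: real assume e: "0 < e"
  then have e2: "0 < e / 2" by simp
  obtain \<mu> where \<mu>: "state T \<mu>" "\<And>x. x \<in> carrier G \<Longrightarrow> \<bar>\<mu> (\<lambda>y. f (y \<otimes> x)) - haar f\<bar> \<le> e / 2"
    using haar_near(1)[OF f e2] unfolding lnear_def by blast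
  have gc: "cont T (\<lambda>x. \<mu> (\<lambda>y. g (y \<otimes> x)))" by (rule cont_left_average[OF \<mu>(1) g])
  obtain \<nu> where \<nu>: "state T \<nu>"
    "\<And>x. x \<in> carrier G \<Longrightarrow> \<bar>\<nu> (\<lambda>z. \<mu> (\<lambda>y. g (y \<otimes> (z \<otimes> x)))) - haar g\<bar> \<le> e / 2"
    using haar_near(1)[OF gc e2] unfolding lnear_def haar_left_average[OF \<mu>(1) g] by blast
  \<comment> \<open>The convolution of \<open>\<mu>\<close> and \<open>\<nu>\<close>.\<close>
  define \<rho> where "\<rho> h = \<nu> (\<lambda>z. \<mu> (\<lambda>y. h (y \<otimes> z)))" for h
  have "state T \<rho>"
    unfolding state_def \<rho>_def
  proof (intro conjI allI impI)
    fix h k assume hk: "cont T h" "cont T k"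
    have "\<nu> (\<lambda>z. \<mu> (\<lambda>y. h (y \<otimes> z) + k (y \<otimes> z))) = \<nu> (\<lambda>z. \<mu> (\<lambda>y. h (y \<otimes> z)) + \<mu> (\<lambda>y. k (y \<otimes> z)))"
      by (rule state_cong[OF \<nu>(1)])
        (use hk in \<open>auto simp: topspace_eq intro!: state_add[OF \<mu>(1)] cont_right_translate
          cont_left_average[OF \<mu>(1), of "\<lambda>x. h x + k x"] continuous_map_add\<close>)
    then show "\<nu> (\<lambda>z. \<mu> (\<lambda>y. h (y \<otimes> z) + k (y \<otimes> z))) = \<nu> (\<lambda>z. \<mu> (\<lambda>y. h (y \<otimes> z))) + \<nu> (\<lambda>z. \<mu> (\<lambda>y. k (y \<otimes> z)))"
      using state_add[OF \<nu>(1) cont_left_average[OF \<mu>(1) hk(1)] cont_left_average[OF \<mu>(1) hk(2)]] by simp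
  next
    fix c h assume h: "cont T h"
    have "\<nu> (\<lambda>z. \<mu> (\<lambda>y. c * h (y \<otimes> z))) = \<nu> (\<lambda>z. c * \<mu> (\<lambda>y. h (y \<otimes> z)))"
      by (rule state_cong[OF \<nu>(1)])
        (use h in \<open>auto simp: topspace_eq intro!: state_cmult[OF \<mu>(1)] cont_right_translate
          cont_left_average[OF \<mu>(1), of "\<lambda>x. c * h x"] continuous_map_real_mult_left\<close>)
    then show "\<nu> (\<lambda>z. \<mu> (\<lambda>y. c * h (y \<otimes> z))) = c * \<nu> (\<lambda>z. \<mu> (\<lambda>y. h (y \<otimes> z)))"
      using state_cmult[OF \<nu>(1) cont_left_average[OF \<mu>(1) h]] by simp
  next
    fix h assume h: "cont T h" "\<forall>x\<in>topspace T. 0 \<le> h x"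
    then show "0 \<le> \<nu> (\<lambda>z. \<mu> (\<lambda>y. h (y \<otimes> z)))"
      by (intro state_nonneg[OF \<nu>(1)] state_nonneg[OF \<mu>(1)] cont_left_average[OF \<mu>(1)] cont_right_translate)
        (auto simp: topspace_eq)
  qed (simp add: state_const[OF \<mu>(1)] state_const[OF \<nu>(1)])
  moreover have "\<bar>\<rho> (\<lambda>y. f (y \<otimes> x) + g (y \<otimes> x)) - (haar f + haar g)\<bar> \<le> e" if x: "x \<in> carrier G" for x
  proof -
    have as: "\<rho> (\<lambda>y. h (y \<otimes> x)) = \<nu> (\<lambda>z. \<mu> (\<lambda>y. h (y \<otimes> (z \<otimes> x))))" if h: "cont T h" for h
      unfolding \<rho>_def
    proof (rule state_cong[OF \<nu>(1) cont_left_average[OF \<mu>(1) cont_right_translate[OF h x]]])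
      fix z assume "z \<in> topspace T"
      then show "\<mu> (\<lambda>y. h (y \<otimes> z \<otimes> x)) = \<mu> (\<lambda>y. h (y \<otimes> (z \<otimes> x)))"
        using x by (intro state_cong[OF \<mu>(1)]) (auto simp: topspace_eq m_assoc intro!: continuous_map_comp[OF h] group_cont)
    qed
    have "\<bar>\<nu> (\<lambda>z. \<mu> (\<lambda>y. f (y \<otimes> (z \<otimes> x)))) - \<nu> (\<lambda>z. haar f)\<bar> \<le> e / 2"
    proof (rule state_lipschitz[OF \<nu>(1)])
      show "cont T (\<lambda>z. \<mu> (\<lambda>y. f (y \<otimes> (z \<otimes> x))))"
        by (rule cont_right_translate[OF cont_left_average[OF \<mu>(1) f] x])
    qed (use \<mu>(2) x in \<open>auto simp: topspace_eq\<close>)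
    then have "\<bar>\<rho> (\<lambda>y. f (y \<otimes> x)) - haar f\<bar> \<le> e / 2" by (simp add: as[OF f] state_const[OF \<nu>(1)])
    moreover have "\<bar>\<rho> (\<lambda>y. g (y \<otimes> x)) - haar g\<bar> \<le> e / 2" using \<nu>(2)[OF x] by (simp add: as[OF g])
    moreover have "\<rho> (\<lambda>y. f (y \<otimes> x) + g (y \<otimes> x)) = \<rho> (\<lambda>y. f (y \<otimes> x)) + \<rho> (\<lambda>y. g (y \<otimes> x))"
      by (intro state_add[OF \<open>state T \<rho>\<close>] cont_right_translate f g x)
    ultimately show ?thesis by linarith
  qed
  ultimately show "lnear e (\<lambda>x. f x + g x) (haar f + haar g)" unfolding lnear_def by blast
qed

lemma state_haar: "state T haar"
  unfolding state_def
proof (intro conjI allI impI)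
  fix c f assume f: "cont T f"
  show "haar (\<lambda>x. c * f x) = c * haar f"
  proof (rule haar_eqI_left[OF continuous_map_real_mult_left[OF f]])
    fix e :: real assume "0 < e"
    then have "0 < e / (\<bar>c\<bar> + 1)" by simp
    then obtain \<mu> where \<mu>: "state T \<mu>" "\<And>x. x \<in> carrier G \<Longrightarrow> \<bar>\<mu> (\<lambda>y. f (y \<otimes> x)) - haar f\<bar> \<le> e / (\<bar>c\<bar> + 1)"
      using haar_near(1)[OF f] unfolding lnear_def by blast
    have "\<bar>\<mu> (\<lambda>y. c * f (y \<otimes> x)) - c * haar f\<bar> \<le> e" if x: "x \<in> carrier G" for x
    proof -
      have "\<bar>\<mu> (\<lambda>y. c * f (y \<otimes> x)) - c * haar f\<bar> = \<bar>c\<bar> * \<bar>\<mu> (\<lambda>y. f (y \<otimes> x)) - haar f\<bar>"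
        using state_cmult[OF \<mu>(1) cont_right_translate[OF f x], of c]
        by (simp flip: abs_mult right_diff_distrib)
      also have "\<dots> \<le> \<bar>c\<bar> * (e / (\<bar>c\<bar> + 1))" by (intro mult_left_mono \<mu>(2) x) simp
      also have "\<dots> \<le> e" using \<open>0 < e\<close> by (simp add: field_simps)
      finally show ?thesis .
    qed
    with \<mu>(1) show "lnear e (\<lambda>x. c * f x) (c * haar f)" unfolding lnear_def by blast
  qed
next
  fix f assume f: "cont T f" "\<forall>x\<in>topspace T. 0 \<le> f x"
  show "0 \<le> haar f"
  proof (rule ccontr)
    assume "\<not> 0 \<le> haar f"
    \<comment> \<open>With this tolerance the average at \<open>\<one>\<close> would be at most
      \<open>haar f / 2 < 0\<close>, against the positivity of \<open>\<mu>\<close>.\<close>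
    then have pos: "0 < - haar f / 2" by simp
    then obtain \<mu> where \<mu>: "state T \<mu>" "\<And>x. x \<in> carrier G \<Longrightarrow> \<bar>\<mu> (\<lambda>y. f (y \<otimes> x)) - haar f\<bar> \<le> - haar f / 2"
      using haar_near(1)[OF f(1)] unfolding lnear_def by blast
    have "0 \<le> \<mu> (\<lambda>y. f (y \<otimes> \<one>))"
      using f by (intro state_nonneg[OF \<mu>(1)] cont_right_translate) (auto simp: topspace_eq)
    with \<mu>(2)[of \<one>] pos show False by simp
  qed
next
  show "haar (\<lambda>x. 1) = 1"
  proof (rule haar_eqI_left)
    fix e :: real assume "0 < e"
    moreover have "state T (\<lambda>f. f \<one>)" by (rule state_eval) (simp add: topspace_eq)
    ultimately show "lnear e (\<lambda>x. 1) 1" unfolding lnear_def by (intro exI[of _ "\<lambda>f. f \<one>"]) simp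
  qed simp
qed (rule haar_add)

text \<open>A left average of the right translate is the left average of \<open>f\<close> read at
  \<open>x \<otimes> g\<close>, so the same states witness both means.\<close>

lemma haar_right_translate:
  assumes f: "cont T f" and g: "g \<in> carrier G"
  shows "haar (\<lambda>x. f (x \<otimes> g)) = haar f"
proof (rule haar_eqI_left[OF cont_right_translate[OF f g]])
  fix e :: real assume "0 < e"
  then obtain \<mu> where \<mu>: "state T \<mu>" "\<And>x. x \<in> carrier G \<Longrightarrow> \<bar>\<mu> (\<lambda>y. f (y \<otimes> x)) - haar f\<bar> \<le> e"
    using haar_near(1)[OF f] unfolding lnear_def by blast
  have "\<mu> (\<lambda>y. f (y \<otimes> x \<otimes> g)) = \<mu> (\<lambda>y. f (y \<otimes> (x \<otimes> g)))" if "x \<in> carrier G" for x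
    by (rule state_cong[OF \<mu>(1)])
      (use that g in \<open>auto simp: topspace_eq m_assoc intro!: continuous_map_comp[OF f] group_cont\<close>)
  then have "\<forall>x\<in>carrier G. \<bar>\<mu> (\<lambda>y. f (y \<otimes> x \<otimes> g)) - haar f\<bar> \<le> e" using \<mu>(2) g by simp
  with \<mu>(1) show "lnear e (\<lambda>x. f (x \<otimes> g)) (haar f)" unfolding lnear_def by blast
qed

lemma haar_inv:
  assumes f: "cont T f"
  shows "haar (\<lambda>x. f (inv x)) = haar f"
  by (rule haar_eqI_left[OF f, symmetric], rule lnear_of_rnear_inv[OF f haar_near(2)[OF cont_inv_arg[OF f]]])

text \<open>By compactness, finitely many right translates of \<open>f\<close> have a sum of at
  least \<open>f x0 / 2\<close> everywhere; by invariance that sum has integral 0.\<close>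

lemma haar_faithful:
  assumes f: "cont T f" and nonneg: "\<And>x. x \<in> carrier G \<Longrightarrow> 0 \<le> f x" and zero: "haar f = 0"
    and x0: "x0 \<in> carrier G"
  shows "f x0 = 0"
proof (rule ccontr)
  assume "f x0 \<noteq> 0"
  with nonneg[OF x0] have "0 < f x0" by simp
  define d where "d = f x0 / 2"
  have pos: "0 < d" using \<open>0 < f x0\<close> by (simp add: d_def)
  \<comment> \<open>\<open>translation_net\<close> multiplies the argument from the left. Using
    \<open>f'\<close> at inverse points reverses the order and yields the values
    \<open>f (x \<otimes> (z \<otimes> x0))\<close>, right translates to which invariance
    applies.\<close>
  define f' where "f' x = f (inv x)" for x
  have f': "cont T f'" unfolding f'_def by (rule cont_inv_arg[OF f])
  obtain Z where Z: "finite Z" "Z \<noteq> {}" "Z \<subseteq> carrier G"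
    and net: "\<And>x x0. x \<in> carrier G \<Longrightarrow> x0 \<in> carrier G \<Longrightarrow>
       \<exists>z\<in>Z. \<forall>y\<in>carrier G. \<bar>f' (y \<otimes> (x0 \<otimes> inv z \<otimes> x)) - f' (y \<otimes> x0)\<bar> < d"
    using translation_net[OF f' pos] by blast
  have gz: "z \<otimes> x0 \<in> carrier G" if "z \<in> Z" for z using that Z(3) x0 by auto
  have c: "cont T (\<lambda>x. f (x \<otimes> (z \<otimes> x0)))" if "z \<in> Z" for z
    by (rule cont_right_translate[OF f gz[OF that]])
  have "d \<le> haar (\<lambda>x. \<Sum>z\<in>Z. f (x \<otimes> (z \<otimes> x0)))"
  proof (rule state_ge_const[OF state_haar])
    show "cont T (\<lambda>x. \<Sum>z\<in>Z. f (x \<otimes> (z \<otimes> x0)))" by (intro continuous_map_sum Z c)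
    fix x assume "x \<in> topspace T"
    then have x: "x \<in> carrier G" by (simp add: topspace_eq)
    obtain z where z: "z \<in> Z" "\<forall>y\<in>carrier G. \<bar>f' (y \<otimes> (inv x0 \<otimes> inv z \<otimes> inv x)) - f' (y \<otimes> inv x0)\<bar> < d"
      using net[OF inv_closed[OF x] inv_closed[OF x0]] by blast
    have zc: "z \<in> carrier G" using z Z by blast
    have "\<bar>f' (inv x0 \<otimes> inv z \<otimes> inv x) - f' (inv x0)\<bar> < d"
      using bspec[OF z(2) one_closed] x x0 zc by (simp del: inv_mult_group)
    moreover have "inv (inv x0 \<otimes> inv z \<otimes> inv x) = x \<otimes> (z \<otimes> x0)"
      using x x0 zc by (simp add: inv_mult_group)
    moreover have "inv (inv x0) = x0" using x0 by simp
    ultimately have "\<bar>f (x \<otimes> (z \<otimes> x0)) - f x0\<bar> < d" unfolding f'_def by metis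
    then have "d \<le> f (x \<otimes> (z \<otimes> x0))" unfolding d_def by linarith
    also have "\<dots> \<le> (\<Sum>z\<in>Z. f (x \<otimes> (z \<otimes> x0)))"
      by (intro member_le_sum[OF z(1) _ Z(1)] nonneg m_closed x) (use Z(3) x0 in auto)
    finally show "d \<le> (\<Sum>z\<in>Z. f (x \<otimes> (z \<otimes> x0)))" .
  qed
  also have "\<dots> = (\<Sum>z\<in>Z. haar (\<lambda>x. f (x \<otimes> (z \<otimes> x0))))" by (intro state_sum[OF state_haar] Z c)
  also have "\<dots> = (\<Sum>z\<in>Z. 0)" by (intro sum.cong refl) (simp only: haar_right_translate[OF f gz] zero)
  also have "\<dots> = 0" by simp
  finally show False using pos by simp
qed

end

subsection \<open>Approximate Riesz representation\<close>

lemma eq_if_dist_le_inverse_Suc: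
  fixes x y C :: real
  assumes "\<And>n. \<bar>x - y\<bar> \<le> C / real (Suc n)"
  shows "x = y"
proof -
  have "(\<lambda>n. C * (1 / real (Suc n))) \<longlonglongrightarrow> C * 0"
    by (intro tendsto_intros LIMSEQ_Suc[OF lim_1_over_n])
  then have "\<bar>x - y\<bar> \<le> C * 0"
    by (rule LIMSEQ_le_const) (use assms in auto)
  then show ?thesis by simp
qed

text \<open>Cauchy-Schwarz against the constant 1: the square of \<open>\<bar>f x\<bar> - c\<close>
  is nonnegative, with \<open>c\<close> the very value to be bounded.\<close>

lemma state_abs_le_sqrt:
  assumes I: "state K I" and f: "cont K f"
  shows "I (\<lambda>x. \<bar>f x\<bar>) \<le> sqrt (I (\<lambda>x. f x * f x))"
proof (rule real_le_rsqrt)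
  define c where "c = I (\<lambda>x. \<bar>f x\<bar>)"
  have af: "cont K (\<lambda>x. \<bar>f x\<bar>)" and ff: "cont K (\<lambda>x. f x * f x)" by (intro cont_intros f)+
  have "0 \<le> I (\<lambda>x. (f x * f x + c * c) - (2 * c) * \<bar>f x\<bar>)"
  proof (rule state_nonneg[OF I])
    show "cont K (\<lambda>x. (f x * f x + c * c) - (2 * c) * \<bar>f x\<bar>)" by (intro cont_intros f)
    fix x
    have "0 \<le> (\<bar>f x\<bar> - c) * (\<bar>f x\<bar> - c)" by simp
    then show "0 \<le> (f x * f x + c * c) - (2 * c) * \<bar>f x\<bar>" by (simp add: algebra_simps)
  qed
  also have "\<dots> = I (\<lambda>x. f x * f x + c * c) - I (\<lambda>x. (2 * c) * \<bar>f x\<bar>)"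
    by (intro state_diff[OF I] cont_intros f)
  also have "I (\<lambda>x. f x * f x + c * c) = I (\<lambda>x. f x * f x) + I (\<lambda>x. c * c)"
    by (intro state_add[OF I] cont_intros f)
  also have "I (\<lambda>x. (2 * c) * \<bar>f x\<bar>) = (2 * c) * c"
    unfolding c_def by (rule state_cmult[OF I af])
  finally have "c * c \<le> I (\<lambda>x. f x * f x)" by (simp add: state_const[OF I])
  then show "(I (\<lambda>x. \<bar>f x\<bar>))\<^sup>2 \<le> I (\<lambda>x. f x * f x)" by (simp add: c_def power2_eq_square)
qed

text \<open>\<open>A\<close> is a near-maximiser of \<open>f \<mapsto> 2 \<alpha> f - I (f\<^sup>2)\<close>; this is the Riesz representation theorem
  for the pre-Hilbert space of continuous functions, which is not complete, so the functional
  \<open>\<alpha>\<close> is only represented up to \<open>e\<close>.\<close>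

lemma state_Riesz_approx:
  assumes I: "state K I" and e: "0 < e" and M: "0 \<le> M"
    and add: "\<And>f g. cont K f \<Longrightarrow> cont K g \<Longrightarrow> \<alpha> (\<lambda>x. f x + g x) = \<alpha> f + \<alpha> g"
    and cmult: "\<And>f c. cont K f \<Longrightarrow> \<alpha> (\<lambda>x. c * f x) = c * \<alpha> f"
    and bound: "\<And>f. cont K f \<Longrightarrow> \<bar>\<alpha> f\<bar> \<le> M * I (\<lambda>x. \<bar>f x\<bar>)"
  shows "\<exists>A. cont K A \<and>
    (\<forall>h. cont K h \<longrightarrow> \<bar>\<alpha> h - I (\<lambda>x. A x * h x)\<bar> \<le> e * sqrt (I (\<lambda>x. h x * h x)))"
proof -
  define J where "J f = 2 * \<alpha> f - I (\<lambda>x. f x * f x)" for f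
  define S where "S = (SUP f\<in>Collect (cont K). J f)"
  have J_le: "J f \<le> M * M" if f: "cont K f" for f
  proof -
    have "(2 * M) * I (\<lambda>x. \<bar>f x\<bar>) = I (\<lambda>x. (2 * M) * \<bar>f x\<bar>)"
      by (rule state_cmult[OF I, symmetric]) (intro cont_intros f)
    also have "\<dots> \<le> I (\<lambda>x. f x * f x + M * M)"
    proof (rule state_mono[OF I])
      show "cont K (\<lambda>x. 2 * M * \<bar>f x\<bar>)" "cont K (\<lambda>x. f x * f x + M * M)" by (intro cont_intros f)+
      fix x
      have "0 \<le> (\<bar>f x\<bar> - M) * (\<bar>f x\<bar> - M)" by simp
      then show "2 * M * \<bar>f x\<bar> \<le> f x * f x + M * M" by (simp add: algebra_simps)
    qed
    also have "\<dots> = I (\<lambda>x. f x * f x) + I (\<lambda>x. M * M)" by (intro state_add[OF I] cont_intros f)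
    finally have "2 * (M * I (\<lambda>x. \<bar>f x\<bar>)) \<le> I (\<lambda>x. f x * f x) + M * M" by (simp add: state_const[OF I])
    with bound[OF f] show ?thesis unfolding J_def by linarith
  qed
  have bdd: "bdd_above (J ` Collect (cont K))" by (rule bdd_aboveI2[of _ _ "M * M"]) (simp add: J_le)
  have J_le_S: "J f \<le> S" if "cont K f" for f
    unfolding S_def by (rule cSUP_upper[OF _ bdd]) (simp add: that)
  \<comment> \<open>The slack is \<open>e * e\<close> because the perturbation argument bounds the
    square of the error by it.\<close>
  have "\<exists>A\<in>Collect (cont K). S - e * e < J A"
  proof (rule ccontr)
    assume "\<not> ?thesis"
    then have "S \<le> S - e * e"
      unfolding S_def by (intro cSUP_least) (auto simp: not_less intro!: exI[of _ "\<lambda>x. 0"])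
    with mult_pos_pos[OF e e] show False by linarith
  qed
  then obtain A where A: "cont K A" "S - e * e < J A" by blast
  have "\<bar>\<alpha> h - I (\<lambda>x. A x * h x)\<bar> \<le> e * sqrt (I (\<lambda>x. h x * h x))" if h: "cont K h" for h
  proof -
    define \<delta> where "\<delta> = \<alpha> h - I (\<lambda>x. A x * h x)"
    define q where "q = I (\<lambda>x. h x * h x)"
    have q0: "0 \<le> q" unfolding q_def by (rule state_nonneg[OF I]) (auto intro: cont_intros h)
    \<comment> \<open>Moving from \<open>A\<close> in the direction \<open>h\<close> gains less than
      the slack. This is a quadratic inequality in \<open>t\<close> whose linear coefficient is the
      representation error \<open>\<delta>\<close>.\<close>
    have *: "2 * t * \<delta> \<le> e * e + t * t * q" for t
    proof -
      have "I (\<lambda>x. (A x + t * h x) * (A x + t * h x)) =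
          I (\<lambda>x. A x * A x + ((2 * t) * (A x * h x) + (t * t) * (h x * h x)))"
        by (simp add: algebra_simps)
      also have "\<dots> = I (\<lambda>x. A x * A x) + I (\<lambda>x. (2 * t) * (A x * h x) + (t * t) * (h x * h x))"
        by (intro state_add[OF I] cont_intros A h)
      also have "I (\<lambda>x. (2 * t) * (A x * h x) + (t * t) * (h x * h x)) =
          I (\<lambda>x. (2 * t) * (A x * h x)) + I (\<lambda>x. (t * t) * (h x * h x))"
        by (intro state_add[OF I] cont_intros A h)
      also have "I (\<lambda>x. (2 * t) * (A x * h x)) = (2 * t) * I (\<lambda>x. A x * h x)"
        by (intro state_cmult[OF I] cont_intros A h)
      also have "I (\<lambda>x. (t * t) * (h x * h x)) = (t * t) * q"
        unfolding q_def by (intro state_cmult[OF I] cont_intros h)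
      finally have 1: "I (\<lambda>x. (A x + t * h x) * (A x + t * h x)) =
          I (\<lambda>x. A x * A x) + ((2 * t) * I (\<lambda>x. A x * h x) + (t * t) * q)" .
      have th: "cont K (\<lambda>x. t * h x)" by (intro cont_intros h)
      have "J (\<lambda>x. A x + t * h x) = J A + 2 * t * \<delta> - t * t * q"
        unfolding J_def 1 add[OF A(1) th] cmult[OF h] \<delta>_def by (simp add: algebra_simps)
      moreover have "J (\<lambda>x. A x + t * h x) \<le> S" by (intro J_le_S cont_intros A h)
      ultimately show ?thesis using A(2) by linarith
    qed
    have "\<delta> * \<delta> \<le> (e * e) * q"
    proof (cases "q = 0")
      \<comment> \<open>The quadratic term is absent, and \<open>t = e * e / \<delta>\<close> makes
        the linear one twice the slack.\<close>
      case True
      have "\<delta> = 0"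
      proof (rule ccontr)
        assume "\<delta> \<noteq> 0"
        with *[of "e * e / \<delta>"] True have "2 * (e * e) \<le> e * e" by simp
        with e show False by (simp add: mult_le_0_iff)
      qed
      then show ?thesis using True by simp
    next
      case False
      with q0 have q: "0 < q" by simp
      \<comment> \<open>\<open>\<delta> / q\<close> is the optimal step of the quadratic.\<close>
      have "2 * (\<delta> / q) * \<delta> \<le> e * e + (\<delta> / q) * (\<delta> / q) * q" by (rule *)
      then have "\<delta> * \<delta> / q \<le> e * e" using q by (simp add: field_simps)
      then show ?thesis using q by (simp add: pos_divide_le_eq)
    qed
    moreover have "(e * sqrt q)\<^sup>2 = (e * e) * q" using q0 by (simp add: power_mult_distrib power2_eq_square[of e])
    ultimately have "\<bar>\<delta>\<bar>\<^sup>2 \<le> (e * sqrt q)\<^sup>2" by (simp add: power2_eq_square[of \<delta>])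
    then show ?thesis
      using power2_le_imp_le[of "\<bar>\<delta>\<bar>" "e * sqrt q"] e q0 unfolding \<delta>_def q_def by simp
  qed
  with A(1) show ?thesis by blast
qed

text \<open>Two approximants nearly represent the same \<open>\<alpha>\<close>; testing against
  their difference bounds its mean-square norm by the sum of the tolerances, and Cauchy-Schwarz
  passes to the mean of the absolute value. The sequence stands in for the density of
  \<open>\<alpha>\<close>, which need not be continuous.\<close>

lemma state_Riesz_sequence:
  assumes I: "state K I" and M: "0 \<le> M"
    and add: "\<And>f g. cont K f \<Longrightarrow> cont K g \<Longrightarrow> \<alpha> (\<lambda>x. f x + g x) = \<alpha> f + \<alpha> g"
    and cmult: "\<And>f c. cont K f \<Longrightarrow> \<alpha> (\<lambda>x. c * f x) = c * \<alpha> f"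
    and bound: "\<And>f. cont K f \<Longrightarrow> \<bar>\<alpha> f\<bar> \<le> M * I (\<lambda>x. \<bar>f x\<bar>)"
  shows "\<exists>A. (\<forall>n. cont K (A n)) \<and>
    (\<forall>n m. I (\<lambda>x. \<bar>A n x - A m x\<bar>) \<le> 1 / real (Suc n) + 1 / real (Suc m)) \<and>
    (\<forall>n h c. cont K h \<longrightarrow> (\<forall>x\<in>topspace K. \<bar>h x\<bar> \<le> c) \<longrightarrow> 0 \<le> c \<longrightarrow>
       \<bar>\<alpha> h - I (\<lambda>x. A n x * h x)\<bar> \<le> c / real (Suc n))"
proof -
  define s where "s n = 1 / real (Suc n)" for n
  have s: "0 < s n" for n by (simp add: s_def)
  have "\<forall>n. \<exists>A. cont K A \<and> (\<forall>h. cont K h \<longrightarrow> \<bar>\<alpha> h - I (\<lambda>x. A x * h x)\<bar> \<le> s n * sqrt (I (\<lambda>x. h x * h x)))"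
    by (intro allI state_Riesz_approx[OF I s M add cmult bound])
  then obtain A where A: "\<And>n. cont K (A n)"
    "\<And>n h. cont K h \<Longrightarrow> \<bar>\<alpha> h - I (\<lambda>x. A n x * h x)\<bar> \<le> s n * sqrt (I (\<lambda>x. h x * h x))"
    by metis
  have "I (\<lambda>x. \<bar>A n x - A m x\<bar>) \<le> s n + s m" for n m
  proof -
    define D where "D x = A n x - A m x" for x
    have D: "cont K D" unfolding D_def by (intro cont_intros A)
    define r where "r = sqrt (I (\<lambda>x. D x * D x))"
    have q0: "0 \<le> I (\<lambda>x. D x * D x)" by (rule state_nonneg[OF I]) (auto intro: cont_intros D)
    have "I (\<lambda>x. D x * D x) = I (\<lambda>x. A n x * D x - A m x * D x)"
      by (simp add: D_def left_diff_distrib)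
    also have "\<dots> = I (\<lambda>x. A n x * D x) - I (\<lambda>x. A m x * D x)"
      by (intro state_diff[OF I] cont_intros A D)
    finally have "r * r \<le> (s n + s m) * r"
      using A(2)[OF D, of n] A(2)[OF D, of m] q0 unfolding r_def by (simp add: distrib_right abs_le_iff)
    moreover have "0 \<le> r" using q0 by (simp add: r_def)
    ultimately have "r \<le> s n + s m"
      using s[of n] s[of m] by (cases "r = 0") (auto simp: mult_le_cancel_right)
    moreover have "I (\<lambda>x. \<bar>D x\<bar>) \<le> r" unfolding r_def by (rule state_abs_le_sqrt[OF I D])
    ultimately show ?thesis by (simp add: D_def)
  qed
  moreover have "\<bar>\<alpha> h - I (\<lambda>x. A n x * h x)\<bar> \<le> c / real (Suc n)"
    if h: "cont K h" "\<forall>x\<in>topspace K. \<bar>h x\<bar> \<le> c" "0 \<le> c" for n h c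
  proof -
    have "I (\<lambda>x. h x * h x) \<le> c * c"
    proof (rule state_le_const[OF I])
      show "cont K (\<lambda>x. h x * h x)" by (intro cont_intros h)
      fix x assume "x \<in> topspace K"
      then have "\<bar>h x\<bar> * \<bar>h x\<bar> \<le> c * c" using h by (intro mult_mono) auto
      then show "h x * h x \<le> c * c" by simp
    qed
    then have "sqrt (I (\<lambda>x. h x * h x)) \<le> c" using h(3) by (intro real_le_lsqrt) (auto simp: power2_eq_square)
    then have "s n * sqrt (I (\<lambda>x. h x * h x)) \<le> s n * c" using s[of n] by (intro mult_left_mono) auto
    with A(2)[OF h(1), of n] show ?thesis by (simp add: s_def)
  qed
  ultimately show ?thesis using A(1) unfolding s_def by blast
qed

subsection \<open>The conditional expectation given the product of the surjections\<close>

locale lifted_haar = compact_group +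
  fixes K1 :: "'c topology" and K2 :: "'d topology" and \<phi> \<psi> \<nu>1 \<nu>2
  assumes K1: "compact_space K1" and K2: "compact_space K2"
    and \<phi>: "continuous_map K1 T \<phi>" and \<psi>: "continuous_map K2 T \<psi>"
    and \<nu>1: "state K1 \<nu>1" and \<nu>2: "state K2 \<nu>2"
    and lift1: "\<And>f. cont T f \<Longrightarrow> \<nu>1 (\<lambda>x. f (\<phi> x)) = haar f"
    and lift2: "\<And>f. cont T f \<Longrightarrow> \<nu>2 (\<lambda>y. f (\<psi> y)) = haar f"
begin

lemma \<phi>_closed: "x \<in> topspace K1 \<Longrightarrow> \<phi> x \<in> carrier G"
  using continuous_map_image_subset_topspace[OF \<phi>] topspace_eq by blast

lemma \<psi>_closed: "y \<in> topspace K2 \<Longrightarrow> \<psi> y \<in> carrier G"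
  using continuous_map_image_subset_topspace[OF \<psi>] topspace_eq by blast

lemma cont2_\<phi>\<psi>:
  assumes u: "cont T u"
  shows "cont2 K1 K2 (\<lambda>x y. u (\<phi> x \<otimes> \<psi> y))"
  by (rule continuous_map_comp[OF u])
    (intro cont_mult continuous_map_comp[OF \<phi> continuous_map_fst] continuous_map_comp[OF \<psi> continuous_map_snd])

section \<open>The pairing and its representing functions\<close>

definition pairing :: "('c \<Rightarrow> 'd \<Rightarrow> real) \<Rightarrow> ('a \<Rightarrow> real) \<Rightarrow> real" where
  "pairing F u = \<nu>2 (\<lambda>y. \<nu>1 (\<lambda>x. F x y * u (\<phi> x \<otimes> \<psi> y)))"

definition represents :: "('c \<Rightarrow> 'd \<Rightarrow> real) \<Rightarrow> ('a \<Rightarrow> real) \<Rightarrow> bool" where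
  "represents F q \<longleftrightarrow> cont T q \<and> (\<forall>u. cont T u \<longrightarrow> haar (\<lambda>g. q g * u g) = pairing F u)"

lemma cont_section1: "cont2 K1 K2 H \<Longrightarrow> cont K2 (\<lambda>y. \<nu>1 (\<lambda>x. H x y))"
  by (rule cont_state_section[OF K1 \<nu>1])

lemma cont2_integrand: "cont2 K1 K2 F \<Longrightarrow> cont T u \<Longrightarrow> cont2 K1 K2 (\<lambda>x y. F x y * u (\<phi> x \<otimes> \<psi> y))"
  by (intro cont_intros cont2_\<phi>\<psi>)

lemma double_state_add:
  assumes "cont2 K1 K2 H" "cont2 K1 K2 H'"
  shows "\<nu>2 (\<lambda>y. \<nu>1 (\<lambda>x. H x y + H' x y)) = \<nu>2 (\<lambda>y. \<nu>1 (\<lambda>x. H x y)) + \<nu>2 (\<lambda>y. \<nu>1 (\<lambda>x. H' x y))"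
proof -
  have "\<nu>2 (\<lambda>y. \<nu>1 (\<lambda>x. H x y + H' x y)) = \<nu>2 (\<lambda>y. \<nu>1 (\<lambda>x. H x y) + \<nu>1 (\<lambda>x. H' x y))"
    by (intro state_cong[OF \<nu>2] cont_section1 state_add[OF \<nu>1] continuous_map_add cont2_section_left[OF assms(1)]
        cont2_section_left[OF assms(2)] assms)
  then show ?thesis by (simp add: state_add[OF \<nu>2 cont_section1[OF assms(1)] cont_section1[OF assms(2)]])
qed

lemma double_state_cmult:
  assumes "cont2 K1 K2 H"
  shows "\<nu>2 (\<lambda>y. \<nu>1 (\<lambda>x. c * H x y)) = c * \<nu>2 (\<lambda>y. \<nu>1 (\<lambda>x. H x y))"
proof -
  have "\<nu>2 (\<lambda>y. \<nu>1 (\<lambda>x. c * H x y)) = \<nu>2 (\<lambda>y. c * \<nu>1 (\<lambda>x. H x y))"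
    by (intro state_cong[OF \<nu>2] cont_section1 state_cmult[OF \<nu>1] continuous_map_real_mult_left
        cont2_section_left[OF assms] assms)
  then show ?thesis by (simp add: state_cmult[OF \<nu>2 cont_section1[OF assms]])
qed

lemma double_state_mono:
  assumes "cont2 K1 K2 H" "cont2 K1 K2 H'"
    and "\<And>x y. x \<in> topspace K1 \<Longrightarrow> y \<in> topspace K2 \<Longrightarrow> H x y \<le> H' x y"
  shows "\<nu>2 (\<lambda>y. \<nu>1 (\<lambda>x. H x y)) \<le> \<nu>2 (\<lambda>y. \<nu>1 (\<lambda>x. H' x y))"
  by (intro state_mono[OF \<nu>2] state_mono[OF \<nu>1] cont_section1 cont2_section_left[OF assms(1)]
      cont2_section_left[OF assms(2)] assms)

lemma double_state_lipschitz:
  assumes "cont2 K1 K2 H" "cont2 K1 K2 H'"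
    and "\<And>x y. x \<in> topspace K1 \<Longrightarrow> y \<in> topspace K2 \<Longrightarrow> \<bar>H x y - H' x y\<bar> \<le> c"
  shows "\<bar>\<nu>2 (\<lambda>y. \<nu>1 (\<lambda>x. H x y)) - \<nu>2 (\<lambda>y. \<nu>1 (\<lambda>x. H' x y))\<bar> \<le> c"
  by (intro state_lipschitz[OF \<nu>2] state_lipschitz[OF \<nu>1] cont_section1 cont2_section_left[OF assms(1)]
      cont2_section_left[OF assms(2)] assms)

text \<open>For fixed \<open>y\<close> the inner functional integrates a right translate of
  \<open>u\<close>, which gives the constant \<open>haar u\<close>. Thus
  \<open>\<phi> x \<otimes> \<psi> y\<close> is Haar distributed.\<close>

lemma double_state_\<phi>\<psi>:
  assumes u: "cont T u"
  shows "\<nu>2 (\<lambda>y. \<nu>1 (\<lambda>x. u (\<phi> x \<otimes> \<psi> y))) = haar u"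
proof -
  have "\<nu>2 (\<lambda>y. \<nu>1 (\<lambda>x. u (\<phi> x \<otimes> \<psi> y))) = \<nu>2 (\<lambda>y. haar u)"
  proof (rule state_cong[OF \<nu>2 cont_section1[OF cont2_\<phi>\<psi>[OF u]]])
    fix y assume "y \<in> topspace K2"
    then have y: "\<psi> y \<in> carrier G" by (rule \<psi>_closed)
    show "\<nu>1 (\<lambda>x. u (\<phi> x \<otimes> \<psi> y)) = haar u"
      by (simp add: lift1[OF cont_right_translate[OF u y]] haar_right_translate[OF u y])
  qed
  then show ?thesis by (simp add: state_const[OF \<nu>2])
qed

lemma represents_cont: "represents F q \<Longrightarrow> cont T q"
  by (simp add: represents_def)

text \<open>A function of the product is its own conditional expectation, as the product is Haar
  distributed. This makes the later projection fix the embedded copy.\<close>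

lemma represents_\<phi>\<psi>:
  assumes f: "cont T f"
  shows "represents (\<lambda>x y. f (\<phi> x \<otimes> \<psi> y)) f"
  unfolding represents_def pairing_def
  using f double_state_\<phi>\<psi>[OF continuous_map_real_mult[OF f]] by simp

lemma represents_add:
  assumes "cont2 K1 K2 F" "cont2 K1 K2 F'" "represents F q" "represents F' q'"
  shows "represents (\<lambda>x y. F x y + F' x y) (\<lambda>g. q g + q' g)"
  unfolding represents_def
proof (intro conjI allI impI)
  have q: "cont T q" "cont T q'" using assms(3,4) by (auto simp: represents_def)
  then show "cont T (\<lambda>g. q g + q' g)" by (rule continuous_map_add)
  fix u assume u: "cont T u"
  have "haar (\<lambda>g. (q g + q' g) * u g) = haar (\<lambda>g. q g * u g + q' g * u g)" by (simp add: distrib_right)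
  also have "\<dots> = haar (\<lambda>g. q g * u g) + haar (\<lambda>g. q' g * u g)"
    by (intro haar_add cont_intros q u)
  also have "\<dots> = pairing F u + pairing F' u" using assms(3,4) u by (simp add: represents_def)
  also have "\<dots> = pairing (\<lambda>x y. F x y + F' x y) u"
    unfolding pairing_def distrib_right
    by (rule double_state_add[OF cont2_integrand[OF assms(1) u] cont2_integrand[OF assms(2) u], symmetric])
  finally show "haar (\<lambda>g. (q g + q' g) * u g) = pairing (\<lambda>x y. F x y + F' x y) u" .
qed

lemma represents_cmult:
  assumes "cont2 K1 K2 F" "represents F q"
  shows "represents (\<lambda>x y. c * F x y) (\<lambda>g. c * q g)"
  unfolding represents_def
proof (intro conjI allI impI)
  have q: "cont T q" using assms(2) by (simp add: represents_def)
  then show "cont T (\<lambda>g. c * q g)" by (rule continuous_map_real_mult_left)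
  fix u assume u: "cont T u"
  have "haar (\<lambda>g. c * q g * u g) = haar (\<lambda>g. c * (q g * u g))" by (simp add: mult.assoc)
  also have "\<dots> = c * haar (\<lambda>g. q g * u g)" by (intro state_cmult[OF state_haar] cont_intros q u)
  also have "\<dots> = c * pairing F u" using assms(2) u by (simp add: represents_def)
  also have "\<dots> = pairing (\<lambda>x y. c * F x y) u"
    unfolding pairing_def mult.assoc
    by (rule double_state_cmult[OF cont2_integrand[OF assms(1) u], symmetric])
  finally show "haar (\<lambda>g. c * q g * u g) = pairing (\<lambda>x y. c * F x y) u" .
qed

text \<open>Tested against \<open>u = max 0 (q - c)\<close>, which is forced to have \<open>haar (u\<^sup>2) = 0\<close>.\<close>

lemma represents_upper_bound:
  assumes F: "cont2 K1 K2 F" and q: "represents F q"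
    and c: "\<And>x y. x \<in> topspace K1 \<Longrightarrow> y \<in> topspace K2 \<Longrightarrow> F x y \<le> c" and g: "g \<in> carrier G"
  shows "q g \<le> c"
proof -
  have qc: "cont T q" by (rule represents_cont[OF q])
  define u where "u x = max 0 (q x - c)" for x
  have u: "cont T u" unfolding u_def by (intro cont_intros qc)
  have "pairing F u \<le> \<nu>2 (\<lambda>y. \<nu>1 (\<lambda>x. c * u (\<phi> x \<otimes> \<psi> y)))"
    unfolding pairing_def
    by (intro double_state_mono cont2_integrand[OF F u] continuous_map_real_mult_left cont2_\<phi>\<psi>[OF u] mult_right_mono c)
      (auto simp: u_def)
  also have "\<dots> = c * haar u"
    unfolding double_state_cmult[OF cont2_\<phi>\<psi>[OF u]] double_state_\<phi>\<psi>[OF u] ..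
  finally have "haar (\<lambda>x. q x * u x) \<le> c * haar u" using q u by (simp add: represents_def)
  moreover have "haar (\<lambda>x. u x * u x) = haar (\<lambda>x. q x * u x - c * u x)"
  proof (rule state_cong[OF state_haar])
    show "cont T (\<lambda>x. u x * u x)" by (intro cont_intros u)
    \<comment> \<open>Where \<open>u\<close> is nonzero it equals \<open>q - c\<close>.\<close>
    show "u x * u x = q x * u x - c * u x" for x by (simp add: u_def max_def algebra_simps)
  qed
  moreover have "\<dots> = haar (\<lambda>x. q x * u x) - haar (\<lambda>x. c * u x)"
    by (intro state_diff[OF state_haar] cont_intros qc u)
  moreover have "haar (\<lambda>x. c * u x) = c * haar u" by (rule state_cmult[OF state_haar u])
  moreover have "0 \<le> haar (\<lambda>x. u x * u x)"
    by (rule state_nonneg[OF state_haar]) (auto intro: cont_intros u)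
  ultimately have "haar (\<lambda>x. u x * u x) = 0" by linarith
  then have "u g * u g = 0"
    using haar_faithful[OF continuous_map_real_mult[OF u u] _ _ g] by simp
  then show ?thesis by (simp add: u_def max_def split: if_splits)
qed

lemma represents_bound:
  assumes F: "cont2 K1 K2 F" and q: "represents F q"
    and c: "\<And>x y. x \<in> topspace K1 \<Longrightarrow> y \<in> topspace K2 \<Longrightarrow> \<bar>F x y\<bar> \<le> c" and g: "g \<in> carrier G"
  shows "\<bar>q g\<bar> \<le> c"
proof -
  have "q g \<le> c"
    by (rule represents_upper_bound[OF F q _ g]) (use c in \<open>auto simp: abs_le_iff\<close>)
  moreover have "(-1) * q g \<le> c"
    by (rule represents_upper_bound[OF continuous_map_real_mult_left[OF F] represents_cmult[OF F q] _ g])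
      (use c in \<open>auto simp: abs_le_iff\<close>)
  ultimately show ?thesis by simp
qed

lemma represents_dist:
  assumes F: "cont2 K1 K2 F" "cont2 K1 K2 F'" and q: "represents F q" "represents F' q'"
    and c: "\<And>x y. x \<in> topspace K1 \<Longrightarrow> y \<in> topspace K2 \<Longrightarrow> \<bar>F x y - F' x y\<bar> \<le> c" and g: "g \<in> carrier G"
  shows "\<bar>q g - q' g\<bar> \<le> c"
proof -
  have F2: "cont2 K1 K2 (\<lambda>x y. (-1) * F' x y)" by (rule continuous_map_real_mult_left[OF F(2)])
  have "\<bar>q g + (-1) * q' g\<bar> \<le> c"
    by (rule represents_bound[OF continuous_map_add[OF F(1) F2]
          represents_add[OF F(1) F2 q(1) represents_cmult[OF F(2) q(2)]] _ g]) (use c in simp)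
  then show ?thesis by simp
qed

text \<open>This is what makes a representative picked by choice depend linearly on
  \<open>F\<close>, as far as its values on the carrier go.\<close>

lemma represents_unique:
  assumes "cont2 K1 K2 F" "represents F q" "represents F q'" "g \<in> carrier G"
  shows "q g = q' g"
  using represents_dist[OF assms(1,1,2,3) _ assms(4), of 0] by simp

text \<open>\<open>q n\<close> is the convolution of the approximate density \<open>A n\<close> of \<open>a\<close> with the functional of \<open>b\<close>. It is
  uniformly Cauchy because \<open>A n\<close> is Cauchy in \<open>L\<^sup>1\<close> and the functional of \<open>b\<close> is dominated by \<open>Mb * haar\<close>.\<close>

lemma represents_tensor:
  assumes a: "cont K1 a" and b: "cont K2 b"
  shows "\<exists>q. represents (\<lambda>x y. a x * b y) q"
proof -
  obtain Ma where Ma: "0 \<le> Ma" "\<And>x. x \<in> topspace K1 \<Longrightarrow> \<bar>a x\<bar> \<le> Ma" using cont_bounded[OF K1 a] by blast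
  obtain Mb where Mb: "0 \<le> Mb" "\<And>y. y \<in> topspace K2 \<Longrightarrow> \<bar>b y\<bar> \<le> Mb" using cont_bounded[OF K2 b] by blast
  define \<alpha> where "\<alpha> f = \<nu>1 (\<lambda>x. a x * f (\<phi> x))" for f
  have af: "cont K1 (\<lambda>x. a x * f (\<phi> x))" if "cont T f" for f
    by (intro cont_intros a continuous_map_comp[OF that \<phi>])
  have \<alpha>_add: "\<alpha> (\<lambda>x. f x + g x) = \<alpha> f + \<alpha> g" if "cont T f" "cont T g" for f g
    unfolding \<alpha>_def distrib_left by (rule state_add[OF \<nu>1 af[OF that(1)] af[OF that(2)]])
  have \<alpha>_cmult: "\<alpha> (\<lambda>x. c * f x) = c * \<alpha> f" if "cont T f" for f c
    unfolding \<alpha>_def mult.left_commute[of _ c] by (rule state_cmult[OF \<nu>1 af[OF that]])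
  \<comment> \<open>Domination by a multiple of \<open>haar\<close> is what provides an approximate
    density; that \<open>\<nu>1\<close> lifts \<open>haar\<close> enters here.\<close>
  have \<alpha>_bound: "\<bar>\<alpha> f\<bar> \<le> Ma * haar (\<lambda>x. \<bar>f x\<bar>)" if f: "cont T f" for f
  proof -
    have fa: "cont T (\<lambda>x. \<bar>f x\<bar>)" by (intro cont_intros f)
    have c: "cont K1 (\<lambda>x. \<bar>f (\<phi> x)\<bar>)" by (rule continuous_map_comp[OF fa \<phi>])
    have "\<bar>\<alpha> f\<bar> \<le> \<nu>1 (\<lambda>x. Ma * \<bar>f (\<phi> x)\<bar>)"
      unfolding \<alpha>_def
      by (rule state_abs_le[OF \<nu>1 af[OF f] continuous_map_real_mult_left[OF c]])
        (simp add: abs_mult Ma mult_right_mono)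
    also have "\<dots> = Ma * \<nu>1 (\<lambda>x. \<bar>f (\<phi> x)\<bar>)" by (rule state_cmult[OF \<nu>1 c])
    also have "\<nu>1 (\<lambda>x. \<bar>f (\<phi> x)\<bar>) = haar (\<lambda>x. \<bar>f x\<bar>)" by (rule lift1[OF fa])
    finally show ?thesis .
  qed
  obtain A where A: "\<And>n. cont T (A n)"
    and A_dist: "\<And>n m. haar (\<lambda>x. \<bar>A n x - A m x\<bar>) \<le> 1 / real (Suc n) + 1 / real (Suc m)"
    and A_approx: "\<And>n h c. cont T h \<Longrightarrow> \<forall>x\<in>topspace T. \<bar>h x\<bar> \<le> c \<Longrightarrow> 0 \<le> c \<Longrightarrow>
       \<bar>\<alpha> h - haar (\<lambda>x. A n x * h x)\<bar> \<le> c / real (Suc n)"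
    using state_Riesz_sequence[OF state_haar Ma(1) \<alpha>_add \<alpha>_cmult \<alpha>_bound] by blast
  define q where "q n g = \<nu>2 (\<lambda>y. b y * A n (g \<otimes> inv (\<psi> y)))" for n g
  have div: "cont2 K2 T (\<lambda>y g. f (g \<otimes> inv (\<psi> y)))" if "cont T f" for f
    by (rule continuous_map_comp[OF that])
      (intro cont_mult cont_inv continuous_map_comp[OF \<psi> continuous_map_fst] continuous_map_snd)
  have bdiv: "cont2 K2 T (\<lambda>y g. b y * f (g \<otimes> inv (\<psi> y)))" if "cont T f" for f
    by (intro cont_intros cont2_left[OF b] div[OF that])
  have qc: "cont T (q n)" for n
    unfolding q_def by (rule cont_state_section[OF K2 \<nu>2 bdiv[OF A]])
  have q_dist: "\<bar>q m g - q n g\<bar> \<le> Mb * (1 / real (Suc m) + 1 / real (Suc n))"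
    if "g \<in> topspace T" for m n g
  proof -
    have g: "g \<in> carrier G" using that by (simp add: topspace_eq)
    define D where "D x = \<bar>A m x - A n x\<bar>" for x
    have D: "cont T D" unfolding D_def by (intro cont_intros A)
    have sec: "cont K2 (\<lambda>y. b y * A k (g \<otimes> inv (\<psi> y)))" for k
      by (rule cont2_section_left[OF bdiv[OF A] that])
    have Dsec: "cont K2 (\<lambda>y. D (g \<otimes> inv (\<psi> y)))" by (rule cont2_section_left[OF div[OF D] that])
    have D': "cont T (\<lambda>h. D (g \<otimes> inv h))"
      by (rule continuous_map_comp[OF D]) (intro group_cont g)
    have "q m g - q n g = \<nu>2 (\<lambda>y. b y * A m (g \<otimes> inv (\<psi> y)) - b y * A n (g \<otimes> inv (\<psi> y)))"
      unfolding q_def by (rule state_diff[OF \<nu>2 sec sec, symmetric])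
    also have "\<bar>\<dots>\<bar> \<le> \<nu>2 (\<lambda>y. Mb * D (g \<otimes> inv (\<psi> y)))"
    proof (rule state_abs_le[OF \<nu>2 continuous_map_diff[OF sec sec] continuous_map_real_mult_left[OF Dsec]])
      fix y assume "y \<in> topspace K2"
      then show "\<bar>b y * A m (g \<otimes> inv (\<psi> y)) - b y * A n (g \<otimes> inv (\<psi> y))\<bar> \<le> Mb * D (g \<otimes> inv (\<psi> y))"
        by (simp add: D_def abs_mult Mb mult_right_mono flip: right_diff_distrib)
    qed
    also have "\<dots> = Mb * \<nu>2 (\<lambda>y. D (g \<otimes> inv (\<psi> y)))" by (rule state_cmult[OF \<nu>2 Dsec])
    also have "\<nu>2 (\<lambda>y. D (g \<otimes> inv (\<psi> y))) = haar (\<lambda>h. D (g \<otimes> inv h))" by (rule lift2[OF D'])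
    \<comment> \<open>The substitution \<open>h \<mapsto> g \<otimes> inv h\<close> is split into a
      right translation and an inversion, each of which preserves \<open>haar\<close>.\<close>
    also have "\<dots> = haar (\<lambda>h. D (inv (h \<otimes> inv g)))"
      by (rule state_cong[OF state_haar D']) (use g in \<open>simp add: topspace_eq inv_mult_group\<close>)
    also have "\<dots> = haar (\<lambda>h. D (inv h))"
      by (rule haar_right_translate[OF cont_inv_arg[OF D]]) (use g in simp)
    also have "\<dots> = haar D" by (rule haar_inv[OF D])
    also have "Mb * haar D \<le> Mb * (1 / real (Suc m) + 1 / real (Suc n))"
      unfolding D_def by (intro mult_left_mono A_dist Mb)
    finally show ?thesis .
  qed
  obtain p where p: "cont T p" "\<And>n g. g \<in> topspace T \<Longrightarrow> \<bar>q n g - p g\<bar> \<le> Mb / real (Suc n)"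
    using cont_uniform_Cauchy_limit[OF qc q_dist] by blast
  have "haar (\<lambda>g. p g * u g) = pairing (\<lambda>x y. a x * b y) u" if u: "cont T u" for u
  proof -
    obtain U where U: "0 \<le> U" "\<And>g. g \<in> topspace T \<Longrightarrow> \<bar>u g\<bar> \<le> U" using cont_bounded[OF compact u] by blast
    have ut: "cont2 T K2 (\<lambda>h y. u (h \<otimes> \<psi> y))"
      by (rule continuous_map_comp[OF u])
        (intro cont_mult continuous_map_comp[OF \<psi> continuous_map_snd] continuous_map_fst)
    \<comment> \<open>Pulling out \<open>b y\<close> leaves \<open>\<alpha>\<close> applied to a
      right translate of \<open>u\<close>, the form in which \<open>A n\<close> can replace
      \<open>\<alpha>\<close>.\<close>
    have pair: "pairing (\<lambda>x y. a x * b y) u = \<nu>2 (\<lambda>y. b y * \<alpha> (\<lambda>h. u (h \<otimes> \<psi> y)))"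
      unfolding pairing_def
    proof (rule state_cong[OF \<nu>2])
      show "cont K2 (\<lambda>y. \<nu>1 (\<lambda>x. a x * b y * u (\<phi> x \<otimes> \<psi> y)))"
        by (intro cont_section1 cont2_integrand[OF _ u] cont_intros cont2_left[OF a] cont2_right[OF b])
      fix y assume y: "y \<in> topspace K2"
      have "\<nu>1 (\<lambda>x. a x * b y * u (\<phi> x \<otimes> \<psi> y)) = \<nu>1 (\<lambda>x. b y * (a x * u (\<phi> x \<otimes> \<psi> y)))"
        by (simp add: mult_ac)
      also have "\<dots> = b y * \<nu>1 (\<lambda>x. a x * u (\<phi> x \<otimes> \<psi> y))"
        by (intro state_cmult[OF \<nu>1] af[where f = "\<lambda>h. u (h \<otimes> \<psi> y)"] cont_right_translate u \<psi>_closed y)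
      finally show "\<nu>1 (\<lambda>x. a x * b y * u (\<phi> x \<otimes> \<psi> y)) = b y * \<alpha> (\<lambda>h. u (h \<otimes> \<psi> y))"
        by (simp add: \<alpha>_def)
    qed
    have \<alpha>_eq: "\<alpha> (\<lambda>h. u (h \<otimes> \<psi> y)) = \<nu>1 (\<lambda>x. a x * u (\<phi> x \<otimes> \<psi> y))" for y by (simp add: \<alpha>_def)
    have pair_cont: "cont K2 (\<lambda>y. b y * \<alpha> (\<lambda>h. u (h \<otimes> \<psi> y)))"
      unfolding \<alpha>_eq by (intro cont_intros b cont_section1 cont2_integrand[OF _ u] cont2_left[OF a])
    have hq: "haar (\<lambda>g. q n g * u g) = \<nu>2 (\<lambda>y. b y * haar (\<lambda>h. A n h * u (h \<otimes> \<psi> y)))"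
      and hq_cont: "cont K2 (\<lambda>y. b y * haar (\<lambda>h. A n h * u (h \<otimes> \<psi> y)))" for n
    proof -
      have bdu: "cont2 K2 T (\<lambda>y g. b y * A n (g \<otimes> inv (\<psi> y)) * u g)"
        by (intro cont_intros bdiv[OF A] cont2_right[OF u])
      have "cont2 T K2 (\<lambda>h y. A n h * u (h \<otimes> \<psi> y))" by (intro cont_intros cont2_left[OF A] ut)
      from cont_state_section[OF compact state_haar this]
      show hc: "cont K2 (\<lambda>y. b y * haar (\<lambda>h. A n h * u (h \<otimes> \<psi> y)))" by (intro cont_intros b)
      have "haar (\<lambda>g. q n g * u g) = haar (\<lambda>g. \<nu>2 (\<lambda>y. b y * A n (g \<otimes> inv (\<psi> y)) * u g))"
      proof (rule state_cong[OF state_haar])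
        show "cont T (\<lambda>g. q n g * u g)" by (intro cont_intros qc u)
        fix g assume "g \<in> topspace T"
        then show "q n g * u g = \<nu>2 (\<lambda>y. b y * A n (g \<otimes> inv (\<psi> y)) * u g)"
          unfolding q_def by (intro state_multc[OF \<nu>2, symmetric] cont2_section_left[OF bdiv[OF A]])
      qed
      also have "\<dots> = \<nu>2 (\<lambda>y. haar (\<lambda>g. b y * A n (g \<otimes> inv (\<psi> y)) * u g))"
        by (rule state_Fubini[OF K2 compact \<nu>2 state_haar bdu, symmetric])
      also have "\<dots> = \<nu>2 (\<lambda>y. b y * haar (\<lambda>h. A n h * u (h \<otimes> \<psi> y)))"
      proof (rule state_cong[OF \<nu>2, symmetric, OF hc])
        fix y assume "y \<in> topspace K2"
        then have y: "\<psi> y \<in> carrier G" by (rule \<psi>_closed)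
        have c1: "cont T (\<lambda>g. A n (g \<otimes> inv (\<psi> y)) * u g)"
          by (intro cont_intros cont_right_translate A u inv_closed y)
        have c2: "cont T (\<lambda>h. A n h * u (h \<otimes> \<psi> y))"
          by (intro cont_intros cont_right_translate A u y)
        \<comment> \<open>Substituting \<open>g = h \<otimes> \<psi> y\<close> moves the translation
          from \<open>A n\<close> to \<open>u\<close>, as in the pairing.\<close>
        have "haar (\<lambda>h. A n h * u (h \<otimes> \<psi> y)) = haar (\<lambda>h. A n (h \<otimes> \<psi> y \<otimes> inv (\<psi> y)) * u (h \<otimes> \<psi> y))"
          by (rule state_cong[OF state_haar c2]) (use y in \<open>simp add: topspace_eq m_assoc\<close>)
        also have "\<dots> = haar (\<lambda>g. A n (g \<otimes> inv (\<psi> y)) * u g)"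
          by (rule haar_right_translate[OF c1 y])
        finally have "b y * haar (\<lambda>h. A n h * u (h \<otimes> \<psi> y)) = b y * haar (\<lambda>g. A n (g \<otimes> inv (\<psi> y)) * u g)"
          by simp
        also have "\<dots> = haar (\<lambda>g. b y * (A n (g \<otimes> inv (\<psi> y)) * u g))"
          by (rule state_cmult[OF state_haar c1, symmetric])
        finally show "b y * haar (\<lambda>h. A n h * u (h \<otimes> \<psi> y)) = haar (\<lambda>g. b y * A n (g \<otimes> inv (\<psi> y)) * u g)"
          by (simp add: mult.assoc)
      qed
      finally show "haar (\<lambda>g. q n g * u g) = \<nu>2 (\<lambda>y. b y * haar (\<lambda>h. A n h * u (h \<otimes> \<psi> y)))" .
    qed
    \<comment> \<open>Two equal errors: the uniform distance from \<open>q n\<close> to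
      \<open>p\<close>, and the replacement of \<open>\<alpha>\<close> by \<open>A n\<close> on
      translates of \<open>u\<close>, all bounded by the same \<open>U\<close>.\<close>
    have "\<bar>haar (\<lambda>g. p g * u g) - pairing (\<lambda>x y. a x * b y) u\<bar> \<le> (2 * (Mb * U)) / real (Suc n)" for n
    proof -
      have "\<bar>haar (\<lambda>g. q n g * u g) - haar (\<lambda>g. p g * u g)\<bar> \<le> (Mb * U) / real (Suc n)"
      proof (rule state_lipschitz[OF state_haar])
        show "cont T (\<lambda>g. q n g * u g)" "cont T (\<lambda>g. p g * u g)" by (intro cont_intros qc p u)+
        fix g assume g: "g \<in> topspace T"
        have "\<bar>q n g - p g\<bar> * \<bar>u g\<bar> \<le> (Mb / real (Suc n)) * U"
          using p(2)[OF g, of n] U(2)[OF g] Mb(1) by (intro mult_mono) auto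
        then show "\<bar>q n g * u g - p g * u g\<bar> \<le> (Mb * U) / real (Suc n)"
          by (simp flip: left_diff_distrib abs_mult)
      qed
      moreover have "\<bar>\<nu>2 (\<lambda>y. b y * \<alpha> (\<lambda>h. u (h \<otimes> \<psi> y))) - \<nu>2 (\<lambda>y. b y * haar (\<lambda>h. A n h * u (h \<otimes> \<psi> y)))\<bar>
          \<le> (Mb * U) / real (Suc n)"
      proof (rule state_lipschitz[OF \<nu>2 pair_cont hq_cont])
        fix y assume y: "y \<in> topspace K2"
        have "\<forall>h\<in>topspace T. \<bar>u (h \<otimes> \<psi> y)\<bar> \<le> U"
          using U(2) \<psi>_closed[OF y] by (simp add: topspace_eq)
        from A_approx[OF cont_right_translate[OF u \<psi>_closed[OF y]] this U(1), of n]
        have "\<bar>b y\<bar> * \<bar>\<alpha> (\<lambda>h. u (h \<otimes> \<psi> y)) - haar (\<lambda>h. A n h * u (h \<otimes> \<psi> y))\<bar> \<le> Mb * (U / real (Suc n))"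
          using Mb(2)[OF y] Mb(1) by (intro mult_mono) auto
        then show "\<bar>b y * \<alpha> (\<lambda>h. u (h \<otimes> \<psi> y)) - b y * haar (\<lambda>h. A n h * u (h \<otimes> \<psi> y))\<bar> \<le> (Mb * U) / real (Suc n)"
          by (simp flip: right_diff_distrib abs_mult)
      qed
      ultimately have "\<bar>haar (\<lambda>g. p g * u g) - pairing (\<lambda>x y. a x * b y) u\<bar> \<le>
          (Mb * U) / real (Suc n) + (Mb * U) / real (Suc n)"
        unfolding pair hq by linarith
      then show ?thesis by (simp flip: add_divide_distrib)
    qed
    then show ?thesis by (rule eq_if_dist_le_inverse_Suc)
  qed
  with p(1) show ?thesis unfolding represents_def by blast
qed

section \<open>From elementary tensors to all continuous functions\<close>

lemma represents_sum:
  assumes "finite Z" "\<And>z. z \<in> Z \<Longrightarrow> cont2 K1 K2 (F z)" "\<And>z. z \<in> Z \<Longrightarrow> \<exists>q. represents (F z) q"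
  shows "\<exists>q. represents (\<lambda>x y. \<Sum>z\<in>Z. F z x y) q"
  using assms
proof (induction Z rule: finite_induct)
  case empty
  then show ?case using represents_\<phi>\<psi>[of "\<lambda>g. 0"] by auto
next
  case (insert z Z)
  then obtain q q' where "represents (F z) q" "represents (\<lambda>x y. \<Sum>z\<in>Z. F z x y) q'" by blast
  then have "represents (\<lambda>x y. F z x y + (\<Sum>z\<in>Z. F z x y)) (\<lambda>g. q g + q' g)"
    using insert by (intro represents_add continuous_map_sum) auto
  then show ?case using insert by auto
qed

text \<open>\<open>represents_dist\<close> converts uniform closeness of the approximants
  \<open>H n\<close> into uniform closeness of their representatives. These converge uniformly, and
  both sides of the defining identity pass to the limit.\<close>

lemma represents_exists:
  assumes F: "cont2 K1 K2 F"
  shows "\<exists>q. represents F q"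
proof -
  have "\<exists>H. cont2 K1 K2 H \<and> (\<exists>q. represents H q) \<and>
      (\<forall>x\<in>topspace K1. \<forall>y\<in>topspace K2. \<bar>F x y - H x y\<bar> \<le> 1 / real (Suc n))" for n
  proof -
    obtain Z b where Z: "finite Z" "Z \<subseteq> topspace K2" and b: "\<And>z. z \<in> Z \<Longrightarrow> cont K2 (b z)"
      and approx: "\<forall>x\<in>topspace K1. \<forall>y\<in>topspace K2. \<bar>F x y - (\<Sum>z\<in>Z. F x z * b z y)\<bar> \<le> 1 / real (Suc n)"
      using cont2_approx_tensor[OF K1 K2 F, of "1 / real (Suc n)"] by auto
    have Fz: "cont K1 (\<lambda>x. F x z)" if "z \<in> Z" for z
      using Z(2) that by (intro cont2_section_left[OF F]) auto
    have "cont2 K1 K2 (\<lambda>x y. F x z * b z y)" if "z \<in> Z" for z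
      by (intro cont_intros cont2_left[OF Fz[OF that]] cont2_right[OF b[OF that]])
    moreover have "\<exists>q. represents (\<lambda>x y. F x z * b z y) q" if "z \<in> Z" for z
      by (rule represents_tensor[OF Fz[OF that] b[OF that]])
    ultimately show ?thesis using approx Z(1)
      by (intro exI[of _ "\<lambda>x y. \<Sum>z\<in>Z. F x z * b z y"] conjI continuous_map_sum represents_sum)
  qed
  then obtain H q where H: "\<And>n. cont2 K1 K2 (H n)" and q: "\<And>n. represents (H n) (q n)"
    and FH: "\<And>n x y. x \<in> topspace K1 \<Longrightarrow> y \<in> topspace K2 \<Longrightarrow> \<bar>F x y - H n x y\<bar> \<le> 1 / real (Suc n)"
    by metis
  have dist: "\<bar>q m g - q n g\<bar> \<le> 1 * (1 / real (Suc m) + 1 / real (Suc n))" if "g \<in> topspace T" for m n g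
  proof (rule represents_dist[OF H H q q])
    fix x y assume "x \<in> topspace K1" "y \<in> topspace K2"
    from FH[OF this, of m] FH[OF this, of n]
    show "\<bar>H m x y - H n x y\<bar> \<le> 1 * (1 / real (Suc m) + 1 / real (Suc n))" unfolding mult_1 by linarith
  qed (use that in \<open>simp add: topspace_eq\<close>)
  obtain p where p: "cont T p" "\<And>n g. g \<in> topspace T \<Longrightarrow> \<bar>q n g - p g\<bar> \<le> 1 / real (Suc n)"
    using cont_uniform_Cauchy_limit[OF represents_cont[OF q] dist] by blast
  have "haar (\<lambda>g. p g * u g) = pairing F u" if u: "cont T u" for u
  proof -
    obtain U where U: "0 \<le> U" "\<And>g. g \<in> topspace T \<Longrightarrow> \<bar>u g\<bar> \<le> U" using cont_bounded[OF compact u] by blast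
    have "\<bar>haar (\<lambda>g. p g * u g) - pairing F u\<bar> \<le> (2 * U) / real (Suc n)" for n
    proof -
      have "\<bar>haar (\<lambda>g. q n g * u g) - haar (\<lambda>g. p g * u g)\<bar> \<le> U / real (Suc n)"
      proof (rule state_lipschitz[OF state_haar])
        show "cont T (\<lambda>g. q n g * u g)" "cont T (\<lambda>g. p g * u g)"
          by (intro cont_intros represents_cont[OF q] p u)+
        fix g assume g: "g \<in> topspace T"
        have "\<bar>q n g - p g\<bar> * \<bar>u g\<bar> \<le> (1 / real (Suc n)) * U"
          using p(2)[OF g, of n] U(2)[OF g] by (intro mult_mono) auto
        then show "\<bar>q n g * u g - p g * u g\<bar> \<le> U / real (Suc n)"
          by (simp flip: left_diff_distrib abs_mult)
      qed
      moreover have "\<bar>pairing F u - pairing (H n) u\<bar> \<le> U / real (Suc n)"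
        unfolding pairing_def
      proof (rule double_state_lipschitz[OF cont2_integrand[OF F u] cont2_integrand[OF H u]])
        fix x y assume xy: "x \<in> topspace K1" "y \<in> topspace K2"
        then have "\<phi> x \<otimes> \<psi> y \<in> topspace T" by (simp add: topspace_eq \<phi>_closed \<psi>_closed)
        then have "\<bar>F x y - H n x y\<bar> * \<bar>u (\<phi> x \<otimes> \<psi> y)\<bar> \<le> (1 / real (Suc n)) * U"
          using FH[OF xy, of n] U(2) by (intro mult_mono) auto
        then show "\<bar>F x y * u (\<phi> x \<otimes> \<psi> y) - H n x y * u (\<phi> x \<otimes> \<psi> y)\<bar> \<le> U / real (Suc n)"
          by (simp flip: left_diff_distrib abs_mult)
      qed
      moreover have "haar (\<lambda>g. q n g * u g) = pairing (H n) u" using q u by (simp add: represents_def)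
      ultimately have "\<bar>haar (\<lambda>g. p g * u g) - pairing F u\<bar> \<le> U / real (Suc n) + U / real (Suc n)" by linarith
      then show ?thesis by (simp flip: add_divide_distrib)
    qed
    then show ?thesis by (rule eq_if_dist_le_inverse_Suc)
  qed
  with p(1) show ?thesis unfolding represents_def by blast
qed

end

subsection \<open>The complemented copy\<close>

lemma sup_norm_upper:
  assumes "compact_space K" "cont K f" "x \<in> topspace K"
  shows "\<bar>f x\<bar> \<le> sup_norm K f"
  unfolding sup_norm_def
proof (rule cSUP_upper[OF assms(3)])
  obtain M where "\<And>x. x \<in> topspace K \<Longrightarrow> \<bar>f x\<bar> \<le> M" using cont_bounded[OF assms(1,2)] by blast
  then show "bdd_above ((\<lambda>x. \<bar>f x\<bar>) ` topspace K)" by (intro bdd_aboveI2)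
qed

context lifted_haar
begin

definition embed :: "('a \<Rightarrow> real) \<Rightarrow> 'c \<times> 'd \<Rightarrow> real" where
  "embed f = (\<lambda>p. if p \<in> topspace (prod_topology K1 K2) then f (\<phi> (fst p) \<otimes> \<psi> (snd p)) else 0)"

text \<open>For \<open>F\<close> in \<open>cfun\<close> the chosen function is determined on the
  carrier only, and \<open>embed\<close> reads no other values.\<close>

definition average :: "('c \<times> 'd \<Rightarrow> real) \<Rightarrow> 'a \<Rightarrow> real" where
  "average F = (SOME q. represents (\<lambda>x y. F (x, y)) q)"

lemma embed_in_cfun:
  assumes f: "cont T f"
  shows "embed f \<in> cfun (prod_topology K1 K2)"
  using continuous_map_eq[OF cont2_\<phi>\<psi>[OF f], of "embed f"] by (simp add: cfun_def embed_def)

lemma embed_cong: "(\<And>g. g \<in> carrier G \<Longrightarrow> f g = f' g) \<Longrightarrow> embed f = embed f'"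
  by (auto simp: embed_def fun_eq_iff \<phi>_closed \<psi>_closed)

lemma cfun_cont2: "F \<in> cfun (prod_topology K1 K2) \<Longrightarrow> cont2 K1 K2 (\<lambda>x y. F (x, y))"
  by (simp add: cfun_def)

lemma average_represents:
  assumes "F \<in> cfun (prod_topology K1 K2)"
  shows "represents (\<lambda>x y. F (x, y)) (average F)"
  unfolding average_def by (rule someI_ex[OF represents_exists[OF cfun_cont2[OF assms]]])

lemma embed_average_eqI:
  assumes "F \<in> cfun (prod_topology K1 K2)" "represents (\<lambda>x y. F (x, y)) q"
  shows "embed (average F) = embed q"
  by (intro embed_cong represents_unique[OF cfun_cont2[OF assms(1)] average_represents[OF assms(1)] assms(2)])

lemma represents_cong:
  assumes "cont2 K1 K2 F" "represents F q"
    and "\<And>x y. x \<in> topspace K1 \<Longrightarrow> y \<in> topspace K2 \<Longrightarrow> F x y = F' x y"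
  shows "represents F' q"
proof -
  have "pairing F' u = pairing F u" if u: "cont T u" for u
    unfolding pairing_def
  proof (rule state_cong[OF \<nu>2, symmetric, OF cont_section1[OF cont2_integrand[OF assms(1) u]]])
    fix y assume y: "y \<in> topspace K2"
    show "\<nu>1 (\<lambda>x. F x y * u (\<phi> x \<otimes> \<psi> y)) = \<nu>1 (\<lambda>x. F' x y * u (\<phi> x \<otimes> \<psi> y))"
      by (rule state_cong[OF \<nu>1 cont2_section_left[OF cont2_integrand[OF assms(1) u] y]]) (simp add: assms(3) y)
  qed
  with assms(2) show ?thesis by (simp add: represents_def)
qed

lemma embed_average_embed:
  assumes f: "cont T f"
  shows "embed (average (embed f)) = embed f"
  by (intro embed_average_eqI embed_in_cfun f represents_cong[OF cont2_\<phi>\<psi>[OF f] represents_\<phi>\<psi>[OF f]])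
    (simp add: embed_def)

text \<open>\<open>average\<close> may return a function with nonzero values off the carrier,
  whereas \<open>cfun T\<close> demands zero there.\<close>

lemma embed_restrict:
  assumes f: "cont T f"
  obtains f' where "f' \<in> cfun T" "embed f' = embed f"
proof
  let ?f' = "\<lambda>g. if g \<in> topspace T then f g else 0"
  show "?f' \<in> cfun T" using continuous_map_eq[OF f, of ?f'] by (simp add: cfun_def)
  show "embed ?f' = embed f" by (rule embed_cong) (simp add: topspace_eq)
qed

lemma complemented_embed:
  assumes ne: "topspace K1 \<noteq> {}" "topspace K2 \<noteq> {}"
  shows "complemented_subspace (prod_topology K1 K2) (embed ` cfun T)"
proof -
  let ?K = "prod_topology K1 K2"
  have cT: "cont T f" if "f \<in> cfun T" for f using that by (simp add: cfun_def)
  have avg: "cont T (average F)" if "F \<in> cfun ?K" for F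
    by (rule represents_cont[OF average_represents[OF that]])
  have "linear_subspace_of (embed ` cfun T) (cfun ?K)"
    unfolding linear_subspace_of_def
  proof (intro conjI ballI allI)
    show "embed ` cfun T \<subseteq> cfun ?K" using embed_in_cfun cT by blast
    have "embed (\<lambda>x. 0) = (\<lambda>x. 0)" "(\<lambda>x. 0) \<in> cfun T" by (auto simp: embed_def cfun_def)
    then show "(\<lambda>x. 0) \<in> embed ` cfun T" by (rule image_eqI[OF sym])
  next
    fix F F' assume "F \<in> embed ` cfun T" "F' \<in> embed ` cfun T"
    then obtain f f' where f: "f \<in> cfun T" "F = embed f" and f': "f' \<in> cfun T" "F' = embed f'" by blast
    have "(\<lambda>x. F x + F' x) = embed (\<lambda>x. f x + f' x)" by (auto simp: f f' embed_def)
    moreover have "(\<lambda>x. f x + f' x) \<in> cfun T" using f f' by (simp add: cfun_def continuous_map_add)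
    ultimately show "(\<lambda>x. F x + F' x) \<in> embed ` cfun T" by blast
  next
    fix c F assume "F \<in> embed ` cfun T"
    then obtain f where f: "f \<in> cfun T" "F = embed f" by blast
    have "(\<lambda>x. c * F x) = embed (\<lambda>x. c * f x)" by (auto simp: f embed_def)
    moreover have "(\<lambda>x. c * f x) \<in> cfun T" using f by (simp add: cfun_def continuous_map_real_mult_left)
    ultimately show "(\<lambda>x. c * F x) \<in> embed ` cfun T" by blast
  qed
  moreover have "\<exists>P. P ` cfun ?K = embed ` cfun T \<and> linear_on (cfun ?K) P \<and>
      (\<exists>C. \<forall>F\<in>cfun ?K. sup_norm ?K (P F) \<le> C * sup_norm ?K F) \<and> (\<forall>F\<in>cfun ?K. P (P F) = P F)"
  proof (intro exI[of _ "\<lambda>F. embed (average F)"] conjI)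
    show "(\<lambda>F. embed (average F)) ` cfun ?K = embed ` cfun T"
    proof (intro equalityI subsetI)
      fix H assume "H \<in> (\<lambda>F. embed (average F)) ` cfun ?K"
      then obtain F where F: "F \<in> cfun ?K" "H = embed (average F)" by blast
      obtain f' where "f' \<in> cfun T" "embed f' = embed (average F)"
        using embed_restrict[OF avg[OF F(1)]] by blast
      then show "H \<in> embed ` cfun T" using F(2) by (intro image_eqI[of _ _ f']) simp_all
    next
      fix H assume "H \<in> embed ` cfun T"
      then obtain f where f: "f \<in> cfun T" "H = embed f" by blast
      then have "H = embed (average (embed f))" using embed_average_embed[OF cT[OF f(1)]] by simp
      then show "H \<in> (\<lambda>F. embed (average F)) ` cfun ?K" using embed_in_cfun[OF cT[OF f(1)]] by blast
    qed
    show "linear_on (cfun ?K) (\<lambda>F. embed (average F))"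
      unfolding linear_on_def
    proof (intro conjI ballI allI)
      fix F F' assume F: "F \<in> cfun ?K" "F' \<in> cfun ?K"
      have "(\<lambda>x. F x + F' x) \<in> cfun ?K" using F by (simp add: cfun_def continuous_map_add)
      then have "embed (average (\<lambda>x. F x + F' x)) = embed (\<lambda>g. average F g + average F' g)"
        by (rule embed_average_eqI) (intro represents_add cfun_cont2 average_represents F)
      also have "\<dots> = (\<lambda>p. embed (average F) p + embed (average F') p)"
        by (auto simp: embed_def)
      finally show "embed (average (\<lambda>x. F x + F' x)) = (\<lambda>p. embed (average F) p + embed (average F') p)" .
    next
      fix c F assume F: "F \<in> cfun ?K"
      have "(\<lambda>x. c * F x) \<in> cfun ?K" using F by (simp add: cfun_def continuous_map_real_mult_left)
      then have "embed (average (\<lambda>x. c * F x)) = embed (\<lambda>g. c * average F g)"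
        by (rule embed_average_eqI) (intro represents_cmult cfun_cont2 average_represents F)
      also have "\<dots> = (\<lambda>p. c * embed (average F) p)"
        by (auto simp: embed_def)
      finally show "embed (average (\<lambda>x. c * F x)) = (\<lambda>p. c * embed (average F) p)" .
    qed
    show "\<exists>C. \<forall>F\<in>cfun ?K. sup_norm ?K (embed (average F)) \<le> C * sup_norm ?K F"
    \<comment> \<open>The constant is 1 because a representing function obeys every bound on the
      absolute value of \<open>F\<close>.\<close>
    proof (intro exI[of _ 1] ballI)
      fix F assume F: "F \<in> cfun ?K"
      have "compact_space ?K" using K1 K2 by (simp add: compact_space_prod_topology)
      then have "\<bar>F (x, y)\<bar> \<le> sup_norm ?K F" if "x \<in> topspace K1" "y \<in> topspace K2" for x y
        using F that by (intro sup_norm_upper) (auto simp: cfun_def)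
      note bound = represents_bound[OF cfun_cont2[OF F] average_represents[OF F] this]
      have "sup_norm ?K (embed (average F)) \<le> sup_norm ?K F"
        unfolding sup_norm_def[of _ "embed _"]
      proof (rule cSUP_least)
        show "topspace ?K \<noteq> {}" using ne by simp
        fix p assume "p \<in> topspace ?K"
        then show "\<bar>embed (average F) p\<bar> \<le> sup_norm ?K F"
          by (auto simp: embed_def \<phi>_closed \<psi>_closed intro!: bound)
      qed
      then show "sup_norm ?K (embed (average F)) \<le> 1 * sup_norm ?K F" by simp
    qed
    show "\<forall>F\<in>cfun ?K. embed (average (embed (average F))) = embed (average F)"
      by (intro ballI embed_average_embed avg)
  qed
  ultimately show ?thesis unfolding complemented_subspace_def by blast
qed

lemma isometric_embed:
  assumes surj: "\<phi> ` topspace K1 = carrier G" "topspace K2 \<noteq> {}"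
  shows "isometric_to_cfun (prod_topology K1 K2) (embed ` cfun T) T"
proof -
  let ?K = "prod_topology K1 K2"
  let ?m = "\<lambda>p. \<phi> (fst p) \<otimes> \<psi> (snd p)"
  have m: "?m ` topspace ?K = carrier G"
  proof (intro equalityI subsetI)
    fix g assume "g \<in> ?m ` topspace ?K"
    then show "g \<in> carrier G" by (auto simp: \<phi>_closed \<psi>_closed)
  next
    fix g assume g: "g \<in> carrier G"
    obtain y where y: "y \<in> topspace K2" using surj(2) by blast
    \<comment> \<open>With one \<open>y\<close> fixed, solving
      \<open>\<phi> x \<otimes> \<psi> y = g\<close> for \<open>\<phi> x\<close> shows the product
      map to be onto; injectivity and isometry both rest on this.\<close>
    have "g \<otimes> inv (\<psi> y) \<in> \<phi> ` topspace K1" using g \<psi>_closed[OF y] surj(1) by simp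
    then obtain x where x: "x \<in> topspace K1" "\<phi> x = g \<otimes> inv (\<psi> y)" by auto
    have "?m (x, y) = g" using g \<psi>_closed[OF y] x(2) by (simp add: m_assoc)
    moreover have "(x, y) \<in> topspace ?K" using x y by simp
    ultimately show "g \<in> ?m ` topspace ?K" by (intro image_eqI[of _ _ "(x, y)"]) simp_all
  qed
  have "inj_on embed (cfun T)"
  proof (rule inj_onI)
    fix f f' assume f: "f \<in> cfun T" "f' \<in> cfun T" "embed f = embed f'"
    show "f = f'"
    proof
      fix g
      show "f g = f' g"
      proof (cases "g \<in> carrier G")
        case True
        then have "g \<in> ?m ` topspace ?K" unfolding m .
        then obtain p where "p \<in> topspace ?K" "g = ?m p" by (rule imageE)
        then show ?thesis using fun_cong[OF f(3), of p] by (simp add: embed_def)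
      next
        case False
        then show ?thesis using f by (simp add: cfun_def topspace_eq)
      qed
    qed
  qed
  moreover have "linear_on (cfun T) embed"
    by (auto simp: linear_on_def embed_def)
  moreover have "sup_norm ?K (embed f) = sup_norm T f" for f
  proof -
    have "(\<lambda>p. \<bar>embed f p\<bar>) ` topspace ?K = (\<lambda>p. \<bar>f (?m p)\<bar>) ` topspace ?K"
      by (rule image_cong) (auto simp: embed_def)
    also have "\<dots> = (\<lambda>g. \<bar>f g\<bar>) ` (?m ` topspace ?K)" by (simp add: image_image)
    finally show ?thesis unfolding sup_norm_def m topspace_eq by simp
  qed
  ultimately show ?thesis
    unfolding isometric_to_cfun_def by (intro exI[of _ embed]) (simp add: bij_betw_def)
qed

end

theorem theorem1p1:
  fixes K1 :: "'a topology" and K2 :: "'b topology"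
    and G :: "('g, 'm) monoid_scheme" and TG :: "'g topology"
  assumes "compact_space K1" "Hausdorff_space K1"
    and "compact_space K2" "Hausdorff_space K2"
    and "compact_topological_group G TG"
    and "\<exists>f. continuous_map K1 TG f \<and> f ` topspace K1 = topspace TG"
    and "\<exists>g. continuous_map K2 TG g \<and> g ` topspace K2 = topspace TG"
  shows "\<exists>Y. complemented_subspace (prod_topology K1 K2) Y \<and>
             isometric_to_cfun (prod_topology K1 K2) Y TG"
proof -
  have G: "group G" "topspace TG = carrier G"
    using assms(5) by (auto simp: compact_topological_group_def)
  interpret group G by (rule G(1))
  interpret compact_group G TG
    by unfold_locales (use assms(5) in \<open>auto simp: compact_topological_group_def case_prod_beta'\<close>)
  obtain \<phi> where surj1: "continuous_map K1 TG \<phi>" "\<phi> ` topspace K1 = topspace TG" using assms(6) by blast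
  obtain \<psi> where surj2: "continuous_map K2 TG \<psi>" "\<psi> ` topspace K2 = topspace TG" using assms(7) by blast
  obtain \<nu>1 where l1: "state K1 \<nu>1" "\<And>f. cont TG f \<Longrightarrow> \<nu>1 (\<lambda>x. f (\<phi> x)) = haar f"
    using state_lift[OF assms(1) surj1 state_haar] by blast
  obtain \<nu>2 where l2: "state K2 \<nu>2" "\<And>f. cont TG f \<Longrightarrow> \<nu>2 (\<lambda>y. f (\<psi> y)) = haar f"
    using state_lift[OF assms(3) surj2 state_haar] by blast
  interpret lifted_haar G TG K1 K2 \<phi> \<psi> \<nu>1 \<nu>2
    by unfold_locales (intro assms surj1 surj2 l1 l2; assumption)+
  \<comment> \<open>The group contains \<open>\<one>\<close>, so spaces mapping onto it are
    nonempty, as the bound on a supremum requires.\<close>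
  have ne: "topspace K1 \<noteq> {}" "topspace K2 \<noteq> {}"
    using surj1(2) surj2(2) one_closed unfolding G(2) by auto
  have "\<phi> ` topspace K1 = carrier G" using surj1(2) G(2) by simp
  from complemented_embed[OF ne] isometric_embed[OF this ne(2)] show ?thesis by blast
qed

end
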